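(* Let $K$ be a field, let $Q$ be a quiver without loops, let $k$ be a vertex of $Q$ such that no 2-cycle passes through $k$, and let $\rho=(C',\Gamma',C'\xrightarrow{\sim}\Gamma')$ be a matching at $k$. Let $S$ be a $\rho$-admissible potential on $Q$ and let $S^*$ be the potential on $Q^*$ obtained from $[S]$ by substituting $-\beta_\gamma^*\alpha_\gamma^*$ for every occurrence of each arrow $\gamma\in\Gamma'$. Consider the potential on $Q$ $$W=W_\rho+S=\sum_{(\alpha,\beta)\in C'}\alpha\beta\gamma_{\alpha,\beta}+S$$ and the potential on $Q^*$ $$W^*=\sum_{(\alpha,\beta)\in C\setminus C'}[\alpha\beta]\beta^*\alpha^*+S^*.$$ Then: (a) The pre-mutation $\widetilde\mu_k(Q,W)$ is right equivalent to $(Q^*,W^* )\oplus(Q_\rho,[W_\rho])$. (b) If $Q$ does not have any 2-cycles and the matching $\rho$ is maximal, then $Q^*=\mu_k(Q)$ and the mutation $\mu_k(Q,W)$ is right equivalent to $(Q^*,W^* )$.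
   Context: **Quivers with potentials.** A quiver is a finite directed graph; paths are composed left to right. $\widehat{KQ}$ is the completion of the path algebra $KQ$ at the ideal generated by the arrows; $e_i$ is the lazy path at $i$. A potential is a (possibly infinite) linear combination of cycles of length at least $2$; it is reduced if all its cycles have length at least $3$. Two potentials are cyclically equivalent if their difference lies in the closure of the span of commutators of $\widehat{KQ}$. Quivers with potential $(Q,W)$, $(Q',W')$ on the same vertex set are right equivalent if there is an algebra isomorphism $\varphi:\widehat{KQ}\to\widehat{KQ'}$ with $\varphi(e_i)=e_i$ for all $i$ and $\varphi(W)$ cyclically equivalent to $W'$. The direct sum $(Q',W')\oplus(Q'',W'')$ has the same vertices, the disjoint union of the arrows, and potential $W'+W''$. A (loop-free) $(Q,W)$ is trivial if the arrows of $Q$ are $2n$ distinct arrows $\alpha_1,\dots,\alpha_n,\beta_1,\dots,\beta_n$ with each $\alpha_r\beta_r$ a 2-cycle, and $W$ is cyclically equivalent to $\varphi(\sum_r\alpha_r\beta_r)$ for an automorphism $\varphi$ of $\widehat{KQ}$ fixing all $e_i$ and mapping the span of the arrows to itself. Every loop-free $(Q,W)$ is right equivalent to the direct sum of a reduced one (its reduced part) and a trivial one, both unique up to right equivalence (Splitting Theorem). **Mutation.** For $i,j\neq k$ let $C_{ij}$ be the set of pairs $(\alpha,\beta)$ of arrows $\alpha:i\to k$, $\beta:k\to j$, let $\Gamma_{ij}$ be the set of arrows from $j$ to $i$, and $C=\bigcup_{i,j\ne k}C_{ij}$. The pre-mutation $\widetilde\mu_k(Q)$ is obtained from $Q$ by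 adding an arrow $[\alpha\beta]:i\to j$ for each $(\alpha,\beta)\in C_{ij}$, and replacing each arrow $\alpha:i\to k$ by $\alpha^*:k\to i$ and each $\beta:k\to j$ by $\beta^*:j\to k$. When $Q$ has no loops or 2-cycles, $\mu_k(Q)$ is obtained from $\widetilde\mu_k(Q)$ by removing a maximal set of disjoint 2-cycles. For a potential $W$ (rotated so that no term starts at $k$), $[W]$ is obtained by replacing every occurrence of $\alpha\beta$, $(\alpha,\beta)\in C$, by $[\alpha\beta]$; $\widetilde\mu_k(Q,W)=(\widetilde\mu_k(Q),\sum_{(\alpha,\beta)\in C}[\alpha\beta]\beta^*\alpha^*+[W])$, and $\mu_k(Q,W)$ is the reduced part of $\widetilde\mu_k(Q,W)$. **Matchings.** A matching $\rho$ at $k$ consists, for each $i,j\neq k$, of subsets $C'_{ij}\subseteq C_{ij}$, $\Gamma'_{ij}\subseteq\Gamma_{ij}$ and a bijection $C'_{ij}\to\Gamma'_{ij}$; put $C'=\bigcup C'_{ij}$, $\Gamma'=\bigcup\Gamma'_{ij}$. The arrow matched to $(\alpha,\beta)\in C'$ is $\gamma_{\alpha,\beta}$; the pair matched to $\gamma\in\Gamma'$ is $(\alpha_\gamma,\beta_\gamma)$. $\rho$ is maximal if $|C'_{ij}|=|\Gamma'_{ij}|=\min\{|C_{ij}|,|\Gamma_{ij}|\}$ for all $i,j\ne k$. $W_\rho=\sum_{(\alpha,\beta)\in C'}\alpha\beta\gamma_{\alpha,\beta}$. The quiver $Q_\rho$ has the vertices of $Q$, and its arrows are those in $\Gamma'$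 together with the arrows $[\alpha\beta]$ for $(\alpha,\beta)\in C'$. The dual quiver $Q^*$ is obtained from $Q$ by adding the arrows $[\alpha\beta]:i\to j$ for $(\alpha,\beta)\in C_{ij}\setminus C'_{ij}$, replacing the arrows $\alpha$, $\beta$ incident to $k$ by reversed arrows $\alpha^*,\beta^*$, and removing all arrows in $\Gamma'$. A potential $S$ on $Q$ is $\rho$-admissible if none of its terms starts at $k$ and, for every $(\alpha,\beta)\in C'$, the path $\alpha\beta$ does not appear in any term of $S$. *)

theory Defs
  imports
    "Graph_Theory.Graph_Theory"
    "HOL-Algebra.Module"
    "HOL-Algebra.QuotRing"
    "HOL-Library.Function_Algebras"
    "HOL-Library.Disjoint_Sets"
begin

section \<open>Completed path algebras\<close>

text \<open>
  A quiver is a multidigraph as in \<^locale>\<open>fin_digraph\<close>. A path is a pair of its starting vertex and its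
  list of arrows, composed left to right; the lazy path at \<open>i\<close> is \<open>(i, [])\<close>.
\<close>

type_synonym ('v, 'e) path = "'v \<times> 'e list"

definition paths :: "('v, 'e) pre_digraph \<Rightarrow> ('v, 'e) path set" where
  "paths Q = {(u, p). \<exists>v. pre_digraph.awalk Q u p v}"

definition path_end :: "('v, 'e) pre_digraph \<Rightarrow> 'v \<Rightarrow> 'e list \<Rightarrow> 'v" where
  "path_end Q u p = last (pre_digraph.awalk_verts Q u p)"

text \<open>
  A finite quiver has finitely many paths of each length, so the completion of its path algebra
  at the ideal generated by the arrows consists of all formal (infinite) linear combinations of
  paths. These are given by their coefficient functions; addition and scalar multiplication are
  pointwise, and the product is convolution along the factorizations of a path.
\<close>

type_synonym ('k, 'v, 'e) series = "('v, 'e) path \<Rightarrow> 'k"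

definition path_mult ::
  "('v, 'e) pre_digraph \<Rightarrow> ('k::field, 'v, 'e) series \<Rightarrow> ('k, 'v, 'e) series \<Rightarrow> ('k, 'v, 'e) series" where
  "path_mult Q f g =
     (\<lambda>(u, p). \<Sum>n\<le>length p. f (u, take n p) * g (path_end Q u (take n p), drop n p))"

definition path_algebra :: "('v, 'e) pre_digraph \<Rightarrow> ('k::field, ('k, 'v, 'e) series) module" where
  "path_algebra Q =
     \<lparr>carrier = {f. \<forall>x. x \<notin> paths Q \<longrightarrow> f x = 0},
      monoid.mult = path_mult Q,
      one = (\<lambda>(u, p). if u \<in> verts Q \<and> p = [] then 1 else 0),
      zero = (\<lambda>x. 0),
      add = (\<lambda>f g x. f x + g x),
      smult = (\<lambda>c f x. c * f x)\<rparr>"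

definition path_elem :: "('v, 'e) path \<Rightarrow> ('k::field, 'v, 'e) series" where
  "path_elem x = (\<lambda>y. if y = x then 1 else 0)"

text \<open>
  The continuous linear extension of a map \<open>h\<close> on the paths of \<open>Q\<close> with finite fibres.
\<close>

definition path_map ::
  "('v, 'e) pre_digraph \<Rightarrow> (('v, 'e) path \<Rightarrow> ('w, 'f) path) \<Rightarrow> ('k::field, 'v, 'e) series \<Rightarrow> ('k, 'w, 'f) series" where
  "path_map Q h f = (\<lambda>y. \<Sum>x\<in>{x \<in> paths Q. h x = y}. f x)"

definition arrow_span :: "('v, 'e) pre_digraph \<Rightarrow> ('k::field, 'v, 'e) series set" where
  "arrow_span Q = {f \<in> carrier (path_algebra Q). \<forall>u p. f (u, p) \<noteq> 0 \<longrightarrow> length p = 1}"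

definition path_algebra_iso ::
  "('v, 'e) pre_digraph \<Rightarrow> ('v, 'f) pre_digraph \<Rightarrow> (('k::field, 'v, 'e) series \<Rightarrow> ('k, 'v, 'f) series) \<Rightarrow> bool" where
  "path_algebra_iso Q Q' \<phi> \<longleftrightarrow>
     \<phi> \<in> ring_iso (path_algebra Q) (path_algebra Q') \<and>
     (\<forall>c. \<forall>f \<in> carrier (path_algebra Q).
        \<phi> (c \<odot>\<^bsub>path_algebra Q\<^esub> f) = c \<odot>\<^bsub>path_algebra Q'\<^esub> \<phi> f) \<and>
     (\<forall>i \<in> verts Q. \<phi> (path_elem (i, [])) = path_elem (i, []))"

section \<open>Quivers with potential\<close>

definition is_potential :: "('v, 'e) pre_digraph \<Rightarrow> ('k::field, 'v, 'e) series \<Rightarrow> bool" where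
  "is_potential Q W \<longleftrightarrow>
     (\<forall>u p. W (u, p) \<noteq> 0 \<longrightarrow> pre_digraph.awalk Q u p u \<and> 2 \<le> length p)"

type_synonym ('k, 'v, 'e) qp = "('v, 'e) pre_digraph \<times> ('k, 'v, 'e) series"

definition is_qp :: "('k::field, 'v, 'e) qp \<Rightarrow> bool" where
  "is_qp X \<longleftrightarrow> fin_digraph (fst X) \<and> is_potential (fst X) (snd X)"

definition commutator_span :: "('v, 'e) pre_digraph \<Rightarrow> ('k::field, 'v, 'e) series set" where
  "commutator_span Q = Modules.module.span (\<lambda>c f x. c * f x)
     {path_mult Q f g - path_mult Q g f | f g.
        f \<in> carrier (path_algebra Q) \<and> g \<in> carrier (path_algebra Q)}"

text \<open>
  Closure in the adic topology: the \<open>n\<close>-th power of the (completed) arrow ideal consists of the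
  series all of whose terms have length at least \<open>n\<close>.
\<close>

definition adic_closure ::
  "('v, 'e) pre_digraph \<Rightarrow> ('k::field, 'v, 'e) series set \<Rightarrow> ('k, 'v, 'e) series set" where
  "adic_closure Q A = {f \<in> carrier (path_algebra Q).
     \<forall>n. \<exists>g \<in> A. \<forall>u p. length p < n \<longrightarrow> f (u, p) = g (u, p)}"

definition cyclically_equivalent ::
  "('v, 'e) pre_digraph \<Rightarrow> ('k::field, 'v, 'e) series \<Rightarrow> ('k, 'v, 'e) series \<Rightarrow> bool" where
  "cyclically_equivalent Q V W \<longleftrightarrow> V - W \<in> adic_closure Q (commutator_span Q)"

definition right_equivalent :: "('k::field, 'v, 'e) qp \<Rightarrow> ('k, 'v, 'f) qp \<Rightarrow> bool" where
  "right_equivalent X Y \<longleftrightarrow>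
     is_qp X \<and> is_qp Y \<and> verts (fst X) = verts (fst Y) \<and>
     (\<exists>\<phi>. path_algebra_iso (fst X) (fst Y) \<phi> \<and>
          cyclically_equivalent (fst Y) (\<phi> (snd X)) (snd Y))"

definition quiver_sum ::
  "('v, 'e) pre_digraph \<Rightarrow> ('v, 'f) pre_digraph \<Rightarrow> ('v, 'e + 'f) pre_digraph" where
  "quiver_sum Q Q' =
     \<lparr>verts = verts Q, arcs = arcs Q <+> arcs Q',
      tail = case_sum (tail Q) (tail Q'), head = case_sum (head Q) (head Q')\<rparr>"

definition qp_sum ::
  "('k::field, 'v, 'e) qp \<Rightarrow> ('k, 'v, 'f) qp \<Rightarrow> ('k, 'v, 'e + 'f) qp" (infixl "\<oplus>\<^sub>q\<^sub>p" 65) where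
  "X \<oplus>\<^sub>q\<^sub>p Y =
     (quiver_sum (fst X) (fst Y),
      path_map (fst X) (map_prod id (map Inl)) (snd X) +
      path_map (fst Y) (map_prod id (map Inr)) (snd Y))"

definition is_reduced :: "('k::field, 'v, 'e) qp \<Rightarrow> bool" where
  "is_reduced X \<longleftrightarrow> is_qp X \<and> (\<forall>u p. snd X (u, p) \<noteq> 0 \<longrightarrow> 3 \<le> length p)"

definition two_cycle :: "('v, 'e) pre_digraph \<Rightarrow> 'e \<Rightarrow> 'e \<Rightarrow> bool" where
  "two_cycle Q a b \<longleftrightarrow>
     a \<in> arcs Q \<and> b \<in> arcs Q \<and> head Q a = tail Q b \<and> head Q b = tail Q a"

definition is_trivial :: "('k::field, 'v, 'e) qp \<Rightarrow> bool" where
  "is_trivial X \<longleftrightarrow> is_qp X \<and> loopfree_digraph (fst X) \<and>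
     (\<exists>as bs \<phi>.
        length as = length bs \<and> distinct (as @ bs) \<and> set (as @ bs) = arcs (fst X) \<and>
        (\<forall>r < length as. two_cycle (fst X) (as ! r) (bs ! r)) \<and>
        path_algebra_iso (fst X) (fst X) \<phi> \<and>
        \<phi> ` arrow_span (fst X) = arrow_span (fst X) \<and>
        cyclically_equivalent (fst X) (snd X)
          (\<phi> (\<Sum>r<length as. path_elem (tail (fst X) (as ! r), [as ! r, bs ! r]))))"

text \<open>
  The reduced part of \<open>X\<close> is only determined up to right equivalence (by the Splitting Theorem)
  and is therefore treated as a relation. A trivial summand of \<open>X\<close> has at most as
  many arrows as \<open>X\<close>, so taking its arrows from the same type is no restriction.
\<close>

definition is_reduced_part :: "('k::field, 'v, 'e) qp \<Rightarrow> ('k, 'v, 'f) qp \<Rightarrow> bool" where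
  "is_reduced_part X R \<longleftrightarrow> is_reduced R \<and>
     (\<exists>T :: ('k, 'v, 'e) qp. is_trivial T \<and> right_equivalent X (R \<oplus>\<^sub>q\<^sub>p T))"

section \<open>Mutation\<close>

definition C_ij :: "('v, 'e) pre_digraph \<Rightarrow> 'v \<Rightarrow> 'v \<Rightarrow> 'v \<Rightarrow> ('e \<times> 'e) set" where
  "C_ij Q k i j = {(a, b). a \<in> arcs Q \<and> b \<in> arcs Q \<and>
     tail Q a = i \<and> head Q a = k \<and> tail Q b = k \<and> head Q b = j}"

definition Gamma_ij :: "('v, 'e) pre_digraph \<Rightarrow> 'v \<Rightarrow> 'v \<Rightarrow> 'e set" where
  "Gamma_ij Q i j = {c \<in> arcs Q. tail Q c = j \<and> head Q c = i}"

definition C_all :: "('v, 'e) pre_digraph \<Rightarrow> 'v \<Rightarrow> ('e \<times> 'e) set" where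
  "C_all Q k = (\<Union>i \<in> verts Q - {k}. \<Union>j \<in> verts Q - {k}. C_ij Q k i j)"

definition Gamma_all :: "('v, 'e) pre_digraph \<Rightarrow> 'v \<Rightarrow> 'e set" where
  "Gamma_all Q k = (\<Union>i \<in> verts Q - {k}. \<Union>j \<in> verts Q - {k}. Gamma_ij Q i j)"

text \<open>
  All quivers derived from \<open>Q\<close> have arrows among the old arrows \<open>a\<close> (\<open>Old a\<close>), the composites
  \<open>[ab]\<close> (\<open>Comp a b\<close>) and the reversed arrows \<open>a*\<close> (\<open>Star a\<close>).
\<close>

datatype 'e mut_arrow = Old 'e | Comp 'e 'e | Star 'e

primrec mut_tail :: "('v, 'e) pre_digraph \<Rightarrow> 'e mut_arrow \<Rightarrow> 'v" where
  "mut_tail Q (Old a) = tail Q a"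
| "mut_tail Q (Comp a b) = tail Q a"
| "mut_tail Q (Star a) = head Q a"

primrec mut_head :: "('v, 'e) pre_digraph \<Rightarrow> 'e mut_arrow \<Rightarrow> 'v" where
  "mut_head Q (Old a) = head Q a"
| "mut_head Q (Comp a b) = head Q b"
| "mut_head Q (Star a) = tail Q a"

definition incident :: "('v, 'e) pre_digraph \<Rightarrow> 'v \<Rightarrow> 'e set" where
  "incident Q k = {a \<in> arcs Q. tail Q a = k \<or> head Q a = k}"

definition premut_quiver :: "('v, 'e) pre_digraph \<Rightarrow> 'v \<Rightarrow> ('v, 'e mut_arrow) pre_digraph" where
  "premut_quiver Q k =
     \<lparr>verts = verts Q,
      arcs = Old ` (arcs Q - incident Q k) \<union> case_prod Comp ` C_all Q k \<union> Star ` incident Q k,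
      tail = mut_tail Q, head = mut_head Q\<rparr>"

text \<open>
  \<open>Q'\<close> arises from the pre-mutation by removing a maximal set \<open>P\<close> of disjoint 2-cycles
  (a 2-cycle being represented by the set of its two arrows).
\<close>

definition two_cycles :: "('v, 'e) pre_digraph \<Rightarrow> 'e set set" where
  "two_cycles Q = {{a, b} | a b. a \<noteq> b \<and> two_cycle Q a b}"

definition is_quiver_mutation ::
  "('v, 'e) pre_digraph \<Rightarrow> 'v \<Rightarrow> ('v, 'e mut_arrow) pre_digraph \<Rightarrow> bool" where
  "is_quiver_mutation Q k Q' \<longleftrightarrow>
     (\<exists>P. P \<subseteq> two_cycles (premut_quiver Q k) \<and> disjoint P \<and>
          (\<forall>P'. P \<subseteq> P' \<and> P' \<subseteq> two_cycles (premut_quiver Q k) \<and> disjoint P' \<longrightarrow> P' = P) \<and>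
          Q' = premut_quiver Q k \<lparr>arcs := arcs (premut_quiver Q k) - \<Union>P\<rparr>)"

text \<open>
  Rotation by one step of the cycles that start at \<open>k\<close>; for loop-free \<open>Q\<close> no term of
  the result starts at \<open>k\<close>.
\<close>

definition rotate_off ::
  "('v, 'e) pre_digraph \<Rightarrow> 'v \<Rightarrow> ('k::field, 'v, 'e) series \<Rightarrow> ('k, 'v, 'e) series" where
  "rotate_off Q k =
     path_map Q (\<lambda>(u, p). if u = k \<and> p \<noteq> [] then (head Q (hd p), rotate1 p) else (u, p))"

text \<open>
  The operation \<open>W \<mapsto> [W]\<close>, for \<open>W\<close> without terms starting at \<open>k\<close>. Distinct occurrences of
  paths \<open>ab\<close> with \<open>(a, b) \<in> C\<close> cannot overlap, so they are replaced from left to right.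
\<close>

fun bracket_list :: "('v, 'e) pre_digraph \<Rightarrow> 'v \<Rightarrow> 'e list \<Rightarrow> 'e mut_arrow list" where
  "bracket_list Q k (a # b # p) =
     (if (a, b) \<in> C_all Q k then Comp a b # bracket_list Q k p
      else Old a # bracket_list Q k (b # p))"
| "bracket_list Q k [a] = [Old a]"
| "bracket_list Q k [] = []"

definition bracket ::
  "('v, 'e) pre_digraph \<Rightarrow> 'v \<Rightarrow> ('k::field, 'v, 'e) series \<Rightarrow> ('k, 'v, 'e mut_arrow) series" where
  "bracket Q k = path_map Q (map_prod id (bracket_list Q k))"

definition star_cycle ::
  "('v, 'e) pre_digraph \<Rightarrow> 'e \<times> 'e \<Rightarrow> ('k::field, 'v, 'e mut_arrow) series" where
  "star_cycle Q = (\<lambda>(a, b). path_elem (tail Q a, [Comp a b, Star b, Star a]))"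

definition premutation :: "'v \<Rightarrow> ('k::field, 'v, 'e) qp \<Rightarrow> ('k, 'v, 'e mut_arrow) qp" where
  "premutation k X =
     (premut_quiver (fst X) k,
      (\<Sum>c \<in> C_all (fst X) k. star_cycle (fst X) c) +
      bracket (fst X) k (rotate_off (fst X) k (snd X)))"

text \<open>
  Like the reduced part, the mutation of a quiver with potential is only determined up to right
  equivalence: \<open>is_mutation k X M\<close> says that \<open>M\<close> is a representative of it.
\<close>

definition is_mutation :: "'v \<Rightarrow> ('k::field, 'v, 'e) qp \<Rightarrow> ('k, 'v, 'f) qp \<Rightarrow> bool" where
  "is_mutation k X M \<longleftrightarrow> is_reduced_part (premutation k X) M"

section \<open>Matchings\<close>

text \<open>
  The families \<open>C'\<^sub>i\<^sub>j\<close>, \<open>\<Gamma>'\<^sub>i\<^sub>j\<close> are encoded by their unions \<open>C'\<close>, \<open>\<Gamma>'\<close>; they are recovered by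
  intersecting with the pairwise disjoint sets \<open>C\<^sub>i\<^sub>j\<close> and \<open>\<Gamma>\<^sub>i\<^sub>j\<close>.
\<close>

record 'e matching =
  C' :: "('e \<times> 'e) set"
  Gamma' :: "'e set"
  mate :: "'e \<times> 'e \<Rightarrow> 'e"

definition is_matching :: "('v, 'e) pre_digraph \<Rightarrow> 'v \<Rightarrow> 'e matching \<Rightarrow> bool" where
  "is_matching Q k \<rho> \<longleftrightarrow>
     C' \<rho> \<subseteq> C_all Q k \<and> Gamma' \<rho> \<subseteq> Gamma_all Q k \<and>
     (\<forall>i \<in> verts Q - {k}. \<forall>j \<in> verts Q - {k}.
        bij_betw (mate \<rho>) (C' \<rho> \<inter> C_ij Q k i j) (Gamma' \<rho> \<inter> Gamma_ij Q i j))"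

definition maximal_matching :: "('v, 'e) pre_digraph \<Rightarrow> 'v \<Rightarrow> 'e matching \<Rightarrow> bool" where
  "maximal_matching Q k \<rho> \<longleftrightarrow> is_matching Q k \<rho> \<and>
     (\<forall>i \<in> verts Q - {k}. \<forall>j \<in> verts Q - {k}.
        card (C' \<rho> \<inter> C_ij Q k i j) = min (card (C_ij Q k i j)) (card (Gamma_ij Q i j)) \<and>
        card (Gamma' \<rho> \<inter> Gamma_ij Q i j) = min (card (C_ij Q k i j)) (card (Gamma_ij Q i j)))"

definition mate_pair :: "'e matching \<Rightarrow> 'e \<Rightarrow> 'e \<times> 'e" where
  "mate_pair \<rho> = inv_into (C' \<rho>) (mate \<rho>)"

definition W_rho :: "('v, 'e) pre_digraph \<Rightarrow> 'e matching \<Rightarrow> ('k::field, 'v, 'e) series" where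
  "W_rho Q \<rho> = (\<Sum>(a, b) \<in> C' \<rho>. path_elem (tail Q a, [a, b, mate \<rho> (a, b)]))"

definition Q_rho :: "('v, 'e) pre_digraph \<Rightarrow> 'e matching \<Rightarrow> ('v, 'e mut_arrow) pre_digraph" where
  "Q_rho Q \<rho> =
     \<lparr>verts = verts Q,
      arcs = Old ` Gamma' \<rho> \<union> case_prod Comp ` C' \<rho>,
      tail = mut_tail Q, head = mut_head Q\<rparr>"

definition dual_quiver ::
  "('v, 'e) pre_digraph \<Rightarrow> 'v \<Rightarrow> 'e matching \<Rightarrow> ('v, 'e mut_arrow) pre_digraph" where
  "dual_quiver Q k \<rho> =
     \<lparr>verts = verts Q,
      arcs = Old ` (arcs Q - incident Q k - Gamma' \<rho>) \<union>
             case_prod Comp ` (C_all Q k - C' \<rho>) \<union> Star ` incident Q k,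
      tail = mut_tail Q, head = mut_head Q\<rparr>"

definition is_admissible ::
  "('v, 'e) pre_digraph \<Rightarrow> 'v \<Rightarrow> 'e matching \<Rightarrow> ('k::field, 'v, 'e) series \<Rightarrow> bool" where
  "is_admissible Q k \<rho> S \<longleftrightarrow> is_potential Q S \<and>
     (\<forall>u p. S (u, p) \<noteq> 0 \<longrightarrow>
        u \<noteq> k \<and> (\<forall>(a, b) \<in> C' \<rho>. \<not> (\<exists>p1 p2. p = p1 @ [a, b] @ p2)))"

text \<open>
  \<open>S*\<close>: every occurrence of \<open>\<gamma> \<in> \<Gamma>'\<close> in a path of \<open>[S]\<close> is replaced by \<open>\<beta>\<^sub>\<gamma>* \<alpha>\<^sub>\<gamma>*\<close> and contributes a
  sign \<open>-1\<close>.
\<close>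

definition subst_arrow :: "'e matching \<Rightarrow> 'e mut_arrow \<Rightarrow> 'e mut_arrow list" where
  "subst_arrow \<rho> x =
     (if x \<in> Old ` Gamma' \<rho>
      then (case mate_pair \<rho> (case x of Old c \<Rightarrow> c) of (a, b) \<Rightarrow> [Star b, Star a])
      else [x])"

definition S_star ::
  "('v, 'e) pre_digraph \<Rightarrow> 'v \<Rightarrow> 'e matching \<Rightarrow> ('k::field, 'v, 'e) series \<Rightarrow> ('k, 'v, 'e mut_arrow) series" where
  "S_star Q k \<rho> S =
     path_map (premut_quiver Q k) (map_prod id (\<lambda>q. concat (map (subst_arrow \<rho>) q)))
       (\<lambda>(u, q). (- 1) ^ length (filter (\<lambda>x. x \<in> Old ` Gamma' \<rho>) q) * bracket Q k S (u, q))"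

definition W_star ::
  "('v, 'e) pre_digraph \<Rightarrow> 'v \<Rightarrow> 'e matching \<Rightarrow> ('k::field, 'v, 'e) series \<Rightarrow> ('k, 'v, 'e mut_arrow) series" where
  "W_star Q k \<rho> S = (\<Sum>c \<in> C_all Q k - C' \<rho>. star_cycle Q c) + S_star Q k \<rho> S"

end

theory Submission
  imports Defs
begin

text \<open>
  The arrows of the pre-mutation are substituted twice. The first automorphism is
  \<open>\<gamma> \<mapsto> \<gamma> - \<beta>* \<alpha>*\<close> for \<open>\<gamma> \<in> \<Gamma>'\<close>; it cancels the terms \<open>[\<alpha>\<beta>]\<beta>*\<alpha>*\<close> with \<open>(\<alpha>, \<beta>) \<in> C'\<close> and turns
  \<open>[S]\<close> into \<open>S*\<close> plus terms that contain some \<open>\<gamma>\<close>. Rotating these so that a \<open>\<gamma>\<close> comes last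
  gives \<open>\<Sum> T\<^sub>\<gamma> \<gamma>\<close>, where by admissibility no \<open>[\<alpha>\<beta>]\<close> with \<open>(\<alpha>, \<beta>) \<in> C'\<close> occurs in \<open>T\<^sub>\<gamma>\<close>. Hence the
  second automorphism \<open>[\<alpha>\<beta>] \<mapsto> [\<alpha>\<beta>] - T\<^sub>\<gamma>\<close> absorbs them into \<open>\<Sum> [\<alpha>\<beta>]\<gamma>\<close>. Both substitutions shift
  a set of arrows by series that avoid this set, so reversing the sign inverts them.
  If \<open>Q\<close> has no 2-cycles and the matching is maximal, the dual quiver has no 2-cycles; so the
  first summand is reduced.
\<close>

section \<open>Series of paths\<close>

text \<open>The obstacle is the completion: an automorphism has to act on infinite series, and
  inverting a general substitution would take a limit. Two devices avoid this. Arrows are sent to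
  series without constant term, so each coefficient of an image is a finite sum over paths of
  bounded length. And since each shift avoids the arrows being shifted, its inverse is exact after
  one step. The two shifts are kept apart because \<open>T\<^sub>\<gamma>\<close> may itself contain
  matched old arrows: only one \<gamma> of each rotated term is stripped off. A single simultaneous
  shift would break the avoidance condition. In part (a) cyclic equivalence enters at one point. The
  second substitution leaves the unrotated terms alone, while the images of the products
  [\<alpha>\<beta>]\<gamma> bring in the rotated ones with a minus sign; so the error is the
  difference of a series and its rotation. The direct sum has its arrows in a sum type, hence the
  final relabelling. In part (b) the potential of the trivial summand is already a sum of 2-cycles
  of the required shape, so the identity serves as its automorphism.\<close>

context pre_digraph
begin

lemma path_end_conv: "path_end G u p = (if p = [] then u else head G (last p))"
  by (simp add: path_end_def awalk_verts_conv)

lemma path_end_append [simp]: "path_end G u (p @ q) = path_end G (path_end G u p) q"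
  by (simp add: path_end_conv)

lemma path_end_Nil [simp]: "path_end G u [] = u"
  by (simp add: path_end_conv)

lemma path_end_Cons [simp]: "path_end G u (x # p) = path_end G (head G x) p"
  using path_end_append[of u "[x]" p] by (simp add: path_end_conv)

text \<open>Indexing by factorizations instead of cut positions turns associativity and the
  multiplicativity of substitutions into reindexings of sums.\<close>

lemma path_mult_sum_splits:
  "path_mult G f g (u, p) =
     (\<Sum>(q, r) \<in> {(q, r). q @ r = p}. f (u, q) * g (path_end G u q, r))"
proof -
  have "(\<Sum>(q, r) \<in> {(q, r). q @ r = p}. f (u, q) * g (path_end G u q, r)) =
      (\<Sum>n\<le>length p. f (u, take n p) * g (path_end G u (take n p), drop n p))"
    by (rule sum.reindex_bij_witness[where i = "\<lambda>n. (take n p, drop n p)" and j = "\<lambda>(q, r). length q"])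
       auto
  then show ?thesis by (simp add: path_mult_def)
qed

end

lemma finite_splits [simp]: "finite {(q, r). q @ r = (p :: 'a list)}"
proof -
  have "(q, r) \<in> (\<lambda>n. (take n p, drop n p)) ` {..length p}" if "q @ r = p" for q r
    using that by (intro image_eqI[where x = "length q"]) auto
  then have "{(q, r). q @ r = p} \<subseteq> (\<lambda>n. (take n p, drop n p)) ` {..length p}"
    by auto
  then show ?thesis by (rule finite_subset) simp
qed

context pre_digraph
begin

lemma path_mult_assoc: "path_mult G (path_mult G f g) h = path_mult G f (path_mult G g h)"
proof (rule ext, clarify)
  fix u and p :: "'b list"
  let ?S = "\<lambda>p :: 'b list. {(q, r). q @ r = p}"
  let ?t = "\<lambda>q r s. f (u, q) * g (path_end G u q, r) * h (path_end G u (q @ r), s)"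
  have "path_mult G (path_mult G f g) h (u, p) =
      (\<Sum>x \<in> ?S p. \<Sum>y \<in> ?S (fst x). ?t (fst y) (snd y) (snd x))"
    unfolding path_mult_sum_splits by (auto simp: sum_distrib_right intro!: sum.cong)
  also have "\<dots> = (\<Sum>(x, y) \<in> Sigma (?S p) (\<lambda>x. ?S (fst x)). ?t (fst y) (snd y) (snd x))"
    by (rule sum.Sigma) auto
  \<comment> \<open>Both index sets describe the factorizations of \<open>p\<close> into three
    parts, obtained by cutting the left or the right factor a second time.\<close>
  also have "\<dots> = (\<Sum>(x, y) \<in> Sigma (?S p) (\<lambda>x. ?S (snd x)). ?t (fst x) (fst y) (snd y))"
    by (rule sum.reindex_bij_witness[where
          i = "\<lambda>(x, y). ((fst x @ fst y, snd y), (fst x, fst y))" and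
          j = "\<lambda>(x, y). ((fst y, snd y @ snd x), (snd y, snd x))"]) auto
  also have "\<dots> = (\<Sum>x \<in> ?S p. \<Sum>y \<in> ?S (snd x). ?t (fst x) (fst y) (snd y))"
    by (rule sum.Sigma[symmetric]) auto
  also have "\<dots> = path_mult G f (path_mult G g h) (u, p)"
    unfolding path_mult_sum_splits by (auto simp: sum_distrib_left mult.assoc intro!: sum.cong)
  finally show "path_mult G (path_mult G f g) h (u, p) = path_mult G f (path_mult G g h) (u, p)" .
qed

lemma path_mult_add_left: "path_mult G (f + g) h = path_mult G f h + path_mult G g h"
  by (auto simp: fun_eq_iff path_mult_def distrib_right sum.distrib)

lemma path_mult_diff_left: "path_mult G (f - g) h = path_mult G f h - path_mult G g h"
  by (auto simp: fun_eq_iff path_mult_def left_diff_distrib sum_subtractf)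

lemma path_mult_diff_right: "path_mult G f (g - h) = path_mult G f g - path_mult G f h"
  by (auto simp: fun_eq_iff path_mult_def right_diff_distrib sum_subtractf)

lemma path_mult_path_elem_left:
  "path_mult G (path_elem (u, p)) g (v, q) =
    (if v = u \<and> (\<exists>r. q = p @ r) then g (path_end G u p, drop (length p) q) else 0)"
proof -
  have "path_mult G (path_elem (u, p)) g (v, q) =
      (\<Sum>x \<in> {(q1, r). q1 @ r = q}. if v = u \<and> x = (p, drop (length p) q)
        then g (path_end G u p, drop (length p) q) else 0)"
    unfolding path_mult_sum_splits
    by (rule sum.cong) (auto simp: path_elem_def split: if_splits)
  then show ?thesis
    by (cases "v = u \<and> (\<exists>r. q = p @ r)") (auto simp: sum.delta' intro!: sum.neutral)
qed

lemma path_mult_lazy_left: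
  assumes "\<And>v q. g (v, q) \<noteq> 0 \<Longrightarrow> v = u"
  shows "path_mult G (path_elem (u, [])) g = g"
  using assms by (auto simp: fun_eq_iff path_mult_path_elem_left)

lemma path_mult_path_elem:
  "path_end G u p = v \<Longrightarrow> path_mult G (path_elem (u, p)) (path_elem (v, q)) = path_elem (u, p @ q)"
  by (subst fun_eq_iff, clarify, subst path_mult_path_elem_left)
     (auto simp: path_elem_def split: if_splits)

text \<open>Multiplying by a path at \<open>w\<close> selects the terms of \<open>f\<close> that end
  at \<open>w\<close>; by assumption these are all its terms, so the product merely appends
  \<open>p\<close>.\<close>

lemma path_mult_path_elem_right:
  assumes "\<And>v q. f (v, q) \<noteq> 0 \<Longrightarrow> path_end G v q = w"
  shows "path_mult G f (path_elem (w, p)) (v, q) =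
    (if \<exists>r. q = r @ p then f (v, take (length q - length p) q) else 0)"
proof -
  have *: "f (v, r) * path_elem (w, p) (path_end G v r, q') = (if q' = p then f (v, r) else 0)" for r q'
    using assms[of v r] by (auto simp: path_elem_def)
  have "path_mult G f (path_elem (w, p)) (v, q) =
      (\<Sum>x \<in> {(r, q1). r @ q1 = q}. if x = (take (length q - length p) q, p)
        then f (v, take (length q - length p) q) else 0)"
    unfolding path_mult_sum_splits * by (intro sum.cong) (auto split: if_splits)
  moreover have "(\<exists>r. q = r @ p) \<longleftrightarrow> (take (length q - length p) q, p) \<in> {(r, q1). r @ q1 = q}"
    by (simp, intro iffI, clarsimp, rule exI, erule sym)
  ultimately show ?thesis by (simp only: sum.delta finite_splits)
qed

end

context wf_digraph
begin

lemma paths_iff: "(u, p) \<in> paths G \<longleftrightarrow> (\<exists>v. awalk u p v)"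
  by (simp add: paths_def)

lemma path_end_awalk: "awalk u p v \<Longrightarrow> path_end G u p = v"
  by (auto simp: path_end_def)

lemma paths_append_iff: "(u, p @ q) \<in> paths G \<longleftrightarrow> (u, p) \<in> paths G \<and> (path_end G u p, q) \<in> paths G"
  by (auto simp: paths_iff path_end_awalk)

lemma carrier_path_algebra: "f \<in> carrier (path_algebra G) \<longleftrightarrow> (\<forall>u p. f (u, p) \<noteq> 0 \<longrightarrow> (u, p) \<in> paths G)"
  by (auto simp: path_algebra_def)

lemma path_algebra_simps [simp]:
  "mult (path_algebra G) = path_mult G"
  "add (path_algebra G) = (\<lambda>f g. f + g)"
  "smult (path_algebra G) = (\<lambda>c f x. c * f x)"
  "one (path_algebra G) = (\<lambda>(u, p). if u \<in> verts G \<and> p = [] then 1 else 0)"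
  by (auto simp: path_algebra_def fun_eq_iff)

lemma path_elem_carrier: "x \<in> paths G \<Longrightarrow> path_elem x \<in> carrier (path_algebra G)"
  by (cases x) (auto simp: carrier_path_algebra path_elem_def split: if_splits)

end

text \<open>Finite in a finite quiver. Sums over it stand in for sums over all paths, since a sum
  over an infinite set is 0 by convention.\<close>

definition bounded_paths :: "('v, 'e) pre_digraph \<Rightarrow> nat \<Rightarrow> ('v, 'e) path set" where
  "bounded_paths Q n = {x \<in> paths Q. length (snd x) \<le> n}"

lemma (in fin_digraph) finite_bounded_paths [simp]: "finite (bounded_paths G n)"
proof (rule finite_subset)
  show "bounded_paths G n \<subseteq> verts G \<times> {p. set p \<subseteq> arcs G \<and> length p \<le> n}"
    unfolding bounded_paths_def paths_def awalk_def by auto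
  show "finite (verts G \<times> {p. set p \<subseteq> arcs G \<and> length p \<le> n})"
    by (simp add: finite_lists_length_le)
qed

section \<open>Substitution homomorphisms\<close>

text \<open>The vertex argument only decides which lazy path closes the recursion; along a walk it
  is the one at the end vertex.\<close>

primrec subst_path ::
  "('v, 'e) pre_digraph \<Rightarrow> ('e \<Rightarrow> ('k::field, 'v, 'e) series) \<Rightarrow> 'v \<Rightarrow> 'e list \<Rightarrow> ('k, 'v, 'e) series" where
  "subst_path Q s u [] = path_elem (u, [])"
| "subst_path Q s u (x # p) = path_mult Q (s x) (subst_path Q s (head Q x) p)"

text \<open>These are the arrow images of continuous endomorphisms that fix every
  \<open>e\<^sub>i\<close> and map the arrow ideal into itself.\<close>

definition is_subst :: "('v, 'e) pre_digraph \<Rightarrow> ('e \<Rightarrow> ('k::field, 'v, 'e) series) \<Rightarrow> bool" where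
  "is_subst Q s \<longleftrightarrow> (\<forall>x \<in> arcs Q. \<forall>u p. s x (u, p) \<noteq> 0 \<longrightarrow>
     u = tail Q x \<and> p \<noteq> [] \<and> pre_digraph.awalk Q u p (head Q x))"

text \<open>
  Under \<^term>\<open>is_subst\<close>, the paths occurring in the image of a path \<open>p\<close> are no shorter than \<open>p\<close>, so
  the truncated sum agrees with the formal sum over all paths.
\<close>

definition subst_series ::
  "('v, 'e) pre_digraph \<Rightarrow> ('e \<Rightarrow> ('k::field, 'v, 'e) series) \<Rightarrow> ('k, 'v, 'e) series \<Rightarrow> ('k, 'v, 'e) series" where
  "subst_series Q s f = (\<lambda>y. \<Sum>x\<in>bounded_paths Q (length (snd y)). f x * subst_path Q s (fst x) (snd x) y)"

context fin_digraph
begin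

text \<open>Each arrow is replaced by nonempty walks with the same ends, so concatenation keeps the
  ends and never shortens. The length bound is what makes truncated sums exact.\<close>

lemma subst_path_support:
  assumes "is_subst G s" "awalk u p v" "subst_path G s u p (w, q) \<noteq> 0"
  shows "w = u" "awalk u q v" "length p \<le> length q"
proof -
  have "w = u \<and> awalk u q v \<and> length p \<le> length q"
    using assms(2,3)
  proof (induction p arbitrary: u w q)
    case Nil
    then show ?case by (auto simp: path_elem_def split: if_splits)
  next
    case (Cons x p)
    then have x: "x \<in> arcs G" "tail G x = u" and p: "awalk (head G x) p v"
      by (auto simp: awalk_Cons_iff)
    from Cons.prems(2) obtain q1 q2 where q: "q = q1 @ q2" "s x (w, q1) \<noteq> 0"
      "subst_path G s (head G x) p (path_end G w q1, q2) \<noteq> 0"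
      by (auto simp: path_mult_sum_splits elim!: sum.not_neutral_contains_not_neutral)
    have 1: "w = u" "q1 \<noteq> []" "awalk u q1 (head G x)"
      using assms(1) x q(2) by (auto simp: is_subst_def)
    have "length p \<le> length q2" "awalk (head G x) q2 v"
      using Cons.IH[OF p q(3)] by auto
    moreover have "length q1 \<ge> 1" using 1(2) by (cases q1) auto
    ultimately show ?case using 1 q(1) by auto
  qed
  then show "w = u" "awalk u q v" "length p \<le> length q" by auto
qed

lemma subst_path_start:
  assumes "is_subst G s" "(u, p) \<in> paths G" "subst_path G s u p (w, q) \<noteq> 0"
  shows "w = u" "path_end G w q = path_end G u p" "(w, q) \<in> paths G" "length p \<le> length q"
proof -
  from assms(2) obtain v where "awalk u p v" by (auto simp: paths_iff)
  note this subst_path_support[OF assms(1) this assms(3)]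
  then show "w = u" "path_end G w q = path_end G u p" "(w, q) \<in> paths G" "length p \<le> length q"
    by (auto simp: paths_iff path_end_awalk)
qed

lemma subst_path_append:
  assumes "is_subst G s" "(u, p @ q) \<in> paths G"
  shows "subst_path G s u (p @ q) = path_mult G (subst_path G s u p) (subst_path G s (path_end G u p) q)"
  using assms(2)
proof (induction p arbitrary: u)
  case Nil
  then show ?case
    using subst_path_start(1)[OF assms(1)] by (simp add: path_mult_lazy_left)
next
  case (Cons x p)
  then have "(head G x, p @ q) \<in> paths G"
    using paths_append_iff[of u "[x]" "p @ q"] by simp
  then show ?case by (simp add: Cons.IH path_mult_assoc)
qed

text \<open>Paths longer than \<open>q\<close> contribute nothing at \<open>q\<close>, so every
  larger cutoff gives the same value. Coefficients at paths of different lengths can then share one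
  cutoff.\<close>

lemma subst_series_bound:
  assumes "is_subst G s" "length q \<le> n"
  shows "subst_series G s f (v, q) = (\<Sum>x\<in>bounded_paths G n. f x * subst_path G s (fst x) (snd x) (v, q))"
  unfolding subst_series_def
proof (rule sum.mono_neutral_left)
  show "\<forall>x\<in>bounded_paths G n - bounded_paths G (length (snd (v, q))).
      f x * subst_path G s (fst x) (snd x) (v, q) = 0"
    using subst_path_start(4)[OF assms(1), of _ _ v q] by (auto simp: bounded_paths_def)
qed (use assms(2) finite_bounded_paths in \<open>auto simp: bounded_paths_def\<close>)

lemma subst_series_carrier:
  assumes "is_subst G s"
  shows "subst_series G s f \<in> carrier (path_algebra G)"
  unfolding carrier_path_algebra subst_series_def
  using subst_path_start(3)[OF assms]
  by (auto elim!: sum.not_neutral_contains_not_neutral simp: bounded_paths_def)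

lemma subst_series_add: "subst_series G s (f + g) = subst_series G s f + subst_series G s g"
  by (simp add: subst_series_def fun_eq_iff distrib_right sum.distrib)

lemma subst_series_zero: "subst_series G s 0 = 0"
  by (simp add: subst_series_def fun_eq_iff)

lemma subst_series_sum: "subst_series G s (\<Sum>i\<in>I. f i) = (\<Sum>i\<in>I. subst_series G s (f i))"
  by (induction I rule: infinite_finite_induct) (simp_all only: sum.infinite sum.empty sum.insert subst_series_add subst_series_zero not_False_eq_True)

lemma subst_series_scale: "subst_series G s (\<lambda>x. c * f x) = (\<lambda>x. c * subst_series G s f x)"
  by (simp add: subst_series_def fun_eq_iff sum_distrib_left mult.assoc)

lemma subst_series_path_elem:
  assumes "is_subst G s" "(u, p) \<in> paths G"
  shows "subst_series G s (path_elem (u, p)) = subst_path G s u p"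
proof (rule ext, clarify)
  fix v and q :: "'b list"
  let ?n = "max (length p) (length q)"
  have bounded: "(u, p) \<in> bounded_paths G ?n" using assms(2) by (simp add: bounded_paths_def)
  have "subst_series G s (path_elem (u, p)) (v, q) =
      (\<Sum>x\<in>bounded_paths G ?n. if x = (u, p) then subst_path G s u p (v, q) else 0)"
    by (subst subst_series_bound[OF assms(1), of _ ?n], simp, rule sum.cong) (auto simp: path_elem_def)
  also have "\<dots> = subst_path G s u p (v, q)"
    using bounded by simp
  finally show "subst_series G s (path_elem (u, p)) (v, q) = subst_path G s u p (v, q)" .
qed

text \<open>Expanding the right-hand side gives pairs of paths. Those that do not compose, or are
  jointly longer than \<open>q\<close>, contribute zero; the others are the factorizations of the
  paths in \<open>B\<close>, to which \<open>subst_path_append\<close> applies.\<close>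

lemma subst_series_mult:
  assumes s: "is_subst G s"
  shows "subst_series G s (path_mult G f g) = path_mult G (subst_series G s f) (subst_series G s g)"
proof (rule ext, clarify)
  fix v and q :: "'b list"
  define B where "B = bounded_paths G (length q)"
  define S where "S = (\<lambda>x. subst_path G s (fst x) (snd x))"
  have fin [simp]: "finite B" by (simp add: B_def)
  define comp where "comp = {(x, y). x \<in> B \<and> y \<in> B \<and> path_end G (fst x) (snd x) = fst y \<and>
    length (snd x) + length (snd y) \<le> length q}"
  have "path_mult G (subst_series G s f) (subst_series G s g) (v, q) =
      (\<Sum>r \<in> {(q1, q2). q1 @ q2 = q}. (\<Sum>x\<in>B. f x * S x (v, fst r)) *
         (\<Sum>y\<in>B. g y * S y (path_end G v (fst r), snd r)))"
    unfolding path_mult_sum_splits B_def S_def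
    by (rule sum.cong) (auto simp: subst_series_bound[OF s, of _ "length q"])
  also have "\<dots> = (\<Sum>r \<in> {(q1, q2). q1 @ q2 = q}. \<Sum>(x, y)\<in>B \<times> B. f x * g y *
      (S x (v, fst r) * S y (path_end G v (fst r), snd r)))"
    by (simp add: sum_product sum.cartesian_product mult_ac)
  also have "\<dots> = (\<Sum>(x, y)\<in>B \<times> B. f x * g y * path_mult G (S x) (S y) (v, q))"
    by (subst sum.swap) (simp add: path_mult_sum_splits sum_distrib_left case_prod_unfold)
  also have "\<dots> = (\<Sum>(x, y)\<in>comp. f x * g y * path_mult G (S x) (S y) (v, q))"
  proof (rule sum.mono_neutral_right)
    show "\<forall>z\<in>B \<times> B - comp. (case z of (x, y) \<Rightarrow> f x * g y * path_mult G (S x) (S y) (v, q)) = 0"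
    proof clarify
      fix x1 x2 y1 y2 assume B: "(x1, x2) \<in> B" "(y1, y2) \<in> B" and nc: "((x1, x2), (y1, y2)) \<notin> comp"
      have "S (x1, x2) (v, q1) * S (y1, y2) (path_end G v q1, q2) = 0" if "q1 @ q2 = q" for q1 q2
      proof (rule ccontr)
        assume "S (x1, x2) (v, q1) * S (y1, y2) (path_end G v q1, q2) \<noteq> 0"
        then have nz: "subst_path G s x1 x2 (v, q1) \<noteq> 0" "subst_path G s y1 y2 (path_end G v q1, q2) \<noteq> 0"
          by (auto simp: S_def)
        have "(x1, x2) \<in> paths G" "(y1, y2) \<in> paths G"
          using B by (auto simp: B_def bounded_paths_def)
        note subst_path_start[OF s this(1) nz(1)] subst_path_start[OF s this(2) nz(2)]
        then have "((x1, x2), (y1, y2)) \<in> comp"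
          using B that by (auto simp: comp_def)
        then show False using nc by contradiction
      qed
      then show "f (x1, x2) * g (y1, y2) * path_mult G (S (x1, x2)) (S (y1, y2)) (v, q) = 0"
        unfolding path_mult_sum_splits by (auto intro!: sum.neutral)
    qed
  qed (auto simp: comp_def)
  also have "\<dots> = (\<Sum>(z, r)\<in>Sigma B (\<lambda>z. {(p1, p2). p1 @ p2 = snd z}).
      f (fst z, fst r) * g (path_end G (fst z) (fst r), snd r) * S z (v, q))"
  \<comment> \<open>Composability lets the start of the second factor be recovered as the end of the
    first.\<close>
  proof (rule sum.reindex_bij_witness[where
        j = "\<lambda>(x, y). ((fst x, snd x @ snd y), (snd x, snd y))" and
        i = "\<lambda>(z, r). ((fst z, fst r), (path_end G (fst z) (fst r), snd r))"], goal_cases)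
    case (3 b)
    then show ?case by (auto simp: B_def bounded_paths_def paths_append_iff comp_def)
  next
    case (4 a)
    then show ?case by (auto simp: B_def bounded_paths_def paths_append_iff comp_def)
  next
    case (5 a)
    then show ?case
      by (auto simp: B_def bounded_paths_def comp_def S_def paths_append_iff subst_path_append[OF s])
  qed (auto simp: comp_def B_def bounded_paths_def paths_append_iff)
  also have "\<dots> = (\<Sum>z\<in>B. \<Sum>r\<in>{(p1, p2). p1 @ p2 = snd z}.
      f (fst z, fst r) * g (path_end G (fst z) (fst r), snd r) * S z (v, q))"
    by (rule sum.Sigma[symmetric]) auto
  also have "\<dots> = subst_series G s (path_mult G f g) (v, q)"
    by (auto simp: subst_series_def path_mult_sum_splits B_def S_def sum_distrib_right case_prod_unfold
        intro!: sum.cong)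
  finally show "subst_series G s (path_mult G f g) (v, q) =
      path_mult G (subst_series G s f) (subst_series G s g) (v, q)" by simp
qed

lemma subst_path_fixed:
  assumes "\<And>x. x \<in> set p \<Longrightarrow> s x = path_elem (tail G x, [x])" "awalk u p v"
  shows "subst_path G s u p = path_elem (u, p)"
  using assms
proof (induction p arbitrary: u)
  case (Cons x p)
  then show ?case by (simp add: awalk_Cons_iff path_mult_path_elem)
qed simp

lemma subst_series_expand:
  assumes "\<And>u p. f (u, p) \<noteq> 0 \<Longrightarrow> (u, p) \<in> paths G \<and> subst_path G s u p = path_elem (u, p)"
  shows "subst_series G s f = f"
proof (rule ext, clarify)
  fix v and q :: "'b list"
  have bounded: "(v, q) \<in> bounded_paths G (length q)" if "f (v, q) \<noteq> 0"
    using assms[OF that] by (simp add: bounded_paths_def)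
  have "subst_series G s f (v, q) =
      (\<Sum>x\<in>bounded_paths G (length q). if x = (v, q) then f (v, q) else 0)"
    unfolding subst_series_def
  proof (rule sum.cong)
    fix x :: "'a \<times> 'b list"
    show "f x * subst_path G s (fst x) (snd x) (v, q) = (if x = (v, q) then f (v, q) else 0)"
      using assms[of "fst x" "snd x"] by (cases "f x = 0") (auto simp: path_elem_def)
  qed simp
  also have "\<dots> = f (v, q)"
    using assms[of v q] bounded by auto
  finally show "subst_series G s f (v, q) = f (v, q)" .
qed

lemma subst_series_fixed:
  assumes "f \<in> carrier (path_algebra G)"
    and "\<And>u p x. f (u, p) \<noteq> 0 \<Longrightarrow> x \<in> set p \<Longrightarrow> s x = path_elem (tail G x, [x])"
  shows "subst_series G s f = f"
proof (rule subst_series_expand)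
  fix u p assume f: "f (u, p) \<noteq> 0"
  then obtain v where "awalk u p v" using assms(1) by (auto simp: carrier_path_algebra paths_iff)
  then show "(u, p) \<in> paths G \<and> subst_path G s u p = path_elem (u, p)"
    using subst_path_fixed[OF assms(2)[OF f]] by (auto simp: paths_iff)
qed

text \<open>Multiplicativity carries the inverse relation from arrows to paths. For series, the
  coefficient at \<open>q\<close> involves only paths no longer than \<open>q\<close>, so two finite
  sums are interchanged.\<close>

lemma subst_series_comp:
  assumes s: "is_subst G s" and t: "is_subst G t"
    and inv: "\<And>x. x \<in> arcs G \<Longrightarrow> subst_series G t (s x) = path_elem (tail G x, [x])"
    and f: "f \<in> carrier (path_algebra G)"
  shows "subst_series G t (subst_series G s f) = f"
proof (rule ext, clarify)
  fix v and q :: "'b list"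
  define B where "B = bounded_paths G (length q)"
  have bounded: "(v, q) \<in> B" if "f (v, q) \<noteq> 0"
    using f that by (simp add: B_def bounded_paths_def carrier_path_algebra)
  have inv_path: "subst_series G t (subst_path G s u p) = path_elem (u, p)" if "(u, p) \<in> paths G" for u p
    using that
  proof (induction p arbitrary: u)
    case Nil
    then show ?case using t by (simp add: subst_series_path_elem)
  next
    case (Cons x p)
    then have x: "x \<in> arcs G" "tail G x = u" and p: "(head G x, p) \<in> paths G"
      by (auto simp: paths_iff awalk_Cons_iff)
    then show ?case
      by (simp add: subst_series_mult[OF t] inv Cons.IH path_mult_path_elem)
  qed
  have "subst_series G t (subst_series G s f) (v, q) =
      (\<Sum>y\<in>B. (\<Sum>x\<in>B. f x * subst_path G s (fst x) (snd x) y) * subst_path G t (fst y) (snd y) (v, q))"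
    unfolding subst_series_def[of _ t] B_def
    by (rule sum.cong) (auto simp: bounded_paths_def subst_series_bound[OF s, of _ "length q", unfolded bounded_paths_def])
  also have "\<dots> = (\<Sum>x\<in>B. f x * subst_series G t (subst_path G s (fst x) (snd x)) (v, q))"
    unfolding sum_distrib_right
    by (subst sum.swap) (simp add: subst_series_def B_def sum_distrib_left mult.assoc)
  also have "\<dots> = (\<Sum>x\<in>B. if x = (v, q) then f (v, q) else 0)"
    by (rule sum.cong) (auto simp: B_def bounded_paths_def inv_path path_elem_def)
  also have "\<dots> = f (v, q)"
    using bounded by (auto simp: B_def)
  finally show "subst_series G t (subst_series G s f) (v, q) = f (v, q)" .
qed

lemma subst_series_one:
  assumes "is_subst G s"
  shows "subst_series G s \<one>\<^bsub>path_algebra G\<^esub> = \<one>\<^bsub>path_algebra G\<^esub>"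
  by (rule subst_series_expand) (auto simp: paths_iff awalk_Nil_iff split: if_splits)

lemma path_algebra_iso_subst_series:
  assumes s: "is_subst G s" and t: "is_subst G t"
    and ts: "\<And>x. x \<in> arcs G \<Longrightarrow> subst_series G t (s x) = path_elem (tail G x, [x])"
    and st: "\<And>x. x \<in> arcs G \<Longrightarrow> subst_series G s (t x) = path_elem (tail G x, [x])"
  shows "path_algebra_iso G G (subst_series G s)"
proof -
  have "bij_betw (subst_series G s) (carrier (path_algebra G)) (carrier (path_algebra G))"
    by (rule bij_betw_byWitness[where f' = "subst_series G t"])
       (auto simp: subst_series_comp[OF s t ts] subst_series_comp[OF t s st] subst_series_carrier s t)
  then show ?thesis
    using subst_series_one[OF s]
    by (auto simp: path_algebra_iso_def ring_iso_def ring_hom_def subst_series_carrier s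
        subst_series_mult[OF s] subst_series_add subst_series_scale subst_series_path_elem[OF s]
        paths_iff awalk_Nil_iff)
qed

end

definition shift_arrows ::
  "('v, 'e) pre_digraph \<Rightarrow> 'e set \<Rightarrow> ('e \<Rightarrow> ('k::field, 'v, 'e) series) \<Rightarrow> 'e \<Rightarrow> ('k, 'v, 'e) series" where
  "shift_arrows Q X T x =
     (if x \<in> X then path_elem (tail Q x, [x]) + T x else path_elem (tail Q x, [x]))"

context fin_digraph
begin

lemma shift_arrows_iso:
  assumes T: "\<And>x u p. x \<in> X \<Longrightarrow> x \<in> arcs G \<Longrightarrow> T x (u, p) \<noteq> 0 \<Longrightarrow>
      u = tail G x \<and> p \<noteq> [] \<and> awalk u p (head G x) \<and> set p \<inter> X = {}"
  shows "is_subst G (shift_arrows G X T)"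
    and "path_algebra_iso G G (subst_series G (shift_arrows G X T))"
proof -
  \<comment> \<open>Stated for every \<open>T'\<close> supported within \<open>T\<close>, so that it
    covers \<open>T\<close> and its negative.\<close>
  have subst: "is_subst G (shift_arrows G X T')"
    if "\<And>x u p. x \<in> X \<Longrightarrow> x \<in> arcs G \<Longrightarrow> T' x (u, p) \<noteq> 0 \<Longrightarrow> T x (u, p) \<noteq> 0" for T' :: "'b \<Rightarrow> ('c, 'a, 'b) series"
    unfolding is_subst_def
  proof (intro ballI allI impI)
    fix x u p assume x: "x \<in> arcs G" and "shift_arrows G X T' x (u, p) \<noteq> 0"
    then have "u = tail G x \<and> p = [x] \<or> x \<in> X \<and> T' x (u, p) \<noteq> 0"
      by (auto simp: shift_arrows_def path_elem_def split: if_splits)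
    then show "u = tail G x \<and> p \<noteq> [] \<and> awalk u p (head G x)"
    proof
      assume "u = tail G x \<and> p = [x]"
      then show ?thesis using x by (simp add: awalk_simps)
    next
      assume "x \<in> X \<and> T' x (u, p) \<noteq> 0"
      then show ?thesis using that[of x u p] T[of x u p] x by blast
    qed
  qed
  \<comment> \<open>The sign is left open: with \<open>T1\<close> equal to \<open>T\<close> or to
    its negative this gives both composites.\<close>
  have inv: "subst_series G (shift_arrows G X T2) (shift_arrows G X T1 x) = path_elem (tail G x, [x])"
    if x: "x \<in> arcs G" and T1: "T1 x = T x \<or> T1 x = - T x" and T2: "T2 = - T1"
      and subst2: "is_subst G (shift_arrows G X T2)"
    for x and T1 T2 :: "'b \<Rightarrow> ('c, 'a, 'b) series"
  proof -
    have "subst_series G (shift_arrows G X T2) (path_elem (tail G x, [x])) =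
        path_mult G (shift_arrows G X T2 x) (path_elem (head G x, []))"
      using x by (subst subst_series_path_elem[OF subst2]) (auto simp: paths_iff awalk_simps)
    \<comment> \<open>The lazy path acts as a right unit because every term of the arrow's image
      ends at the head of \<open>x\<close>.\<close>
    also have "\<dots> = shift_arrows G X T2 x"
    proof (rule ext, clarify)
      fix v and q :: "'b list"
      show "path_mult G (shift_arrows G X T2 x) (path_elem (head G x, [])) (v, q) = shift_arrows G X T2 x (v, q)"
        using subst2 x by (subst path_mult_path_elem_right) (auto simp: is_subst_def path_end_awalk)
    qed
    finally have 1: "subst_series G (shift_arrows G X T2) (path_elem (tail G x, [x])) = shift_arrows G X T2 x" .
    have 2: "subst_series G (shift_arrows G X T2) (T1 x) = T1 x" if "x \<in> X"
    proof (rule subst_series_fixed)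
      have T1': "T x (u, p) \<noteq> 0" if "T1 x (u, p) \<noteq> 0" for u p
        using T1 that by auto
      show "T1 x \<in> carrier (path_algebra G)"
        using T[OF \<open>x \<in> X\<close> x T1'] by (auto simp: carrier_path_algebra paths_iff)
      show "shift_arrows G X T2 y = path_elem (tail G y, [y])" if "T1 x (u, p) \<noteq> 0" "y \<in> set p" for u p y
        using T[OF \<open>x \<in> X\<close> x T1'[OF that(1)]] that(2) by (auto simp: shift_arrows_def)
    qed
    show ?thesis
    proof (cases "x \<in> X")
      case True
      then have "subst_series G (shift_arrows G X T2) (shift_arrows G X T1 x) = shift_arrows G X T2 x + T1 x"
        by (simp add: shift_arrows_def[of G X T1] subst_series_add 1 2)
      then show ?thesis using True by (simp add: shift_arrows_def T2)
    next
      case False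
      then show ?thesis using 1 by (simp add: shift_arrows_def)
    qed
  qed
  show s: "is_subst G (shift_arrows G X T)" by (rule subst)
  have t: "is_subst G (shift_arrows G X (- T))" by (rule subst) simp
  show "path_algebra_iso G G (subst_series G (shift_arrows G X T))"
    by (rule path_algebra_iso_subst_series[OF s t]; rule inv) (auto simp: s t)
qed

end

section \<open>Linear extensions of maps on paths\<close>

lemma sum_fun_apply: "(\<Sum>i\<in>I. f i) x = (\<Sum>i\<in>I. f i x :: 'a::comm_monoid_add)"
  by (induction I rule: infinite_finite_induct) simp_all

lemma path_map_add: "path_map Q h (f + g) = path_map Q h f + path_map Q h g"
  by (simp add: path_map_def fun_eq_iff sum.distrib)

lemma path_map_zero: "path_map Q h 0 = 0"
  by (simp add: path_map_def fun_eq_iff)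

lemma path_map_sum: "path_map Q h (\<Sum>i\<in>I. f i) = (\<Sum>i\<in>I. path_map Q h (f i))"
  by (induction I rule: infinite_finite_induct)
     (simp_all only: sum.infinite sum.empty sum.insert path_map_add path_map_zero not_False_eq_True)

lemma path_map_nonzeroE:
  assumes "path_map Q h f y \<noteq> 0"
  obtains x where "x \<in> paths Q" "h x = y" "f x \<noteq> 0"
  using assms unfolding path_map_def
  by (elim sum.not_neutral_contains_not_neutral) auto

lemma path_map_inj:
  assumes "inj_on h (paths Q)" "x \<in> paths Q"
  shows "path_map Q h f (h x) = f x"
proof -
  have "{x' \<in> paths Q. h x' = h x} = {x}"
    using assms by (auto simp: inj_on_def)
  then show ?thesis by (simp add: path_map_def)
qed

lemma path_map_path_elem:
  assumes "inj_on h (paths Q)" "x \<in> paths Q"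
  shows "path_map Q h (path_elem x) = path_elem (h x)"
proof
  fix y
  show "path_map Q h (path_elem x) y = path_elem (h x) y"
  proof (cases "y = h x")
    case True
    then show ?thesis by (simp add: path_map_inj[OF assms] path_elem_def)
  next
    case False
    then have "path_map Q h (path_elem x) y = 0"
      by (rule_tac ccontr) (auto simp: path_elem_def elim!: path_map_nonzeroE split: if_splits)
    then show ?thesis using False by (simp add: path_elem_def)
  qed
qed

lemma inj_map_prod_map: "inj h \<Longrightarrow> inj_on (map_prod id (map h)) A"
  by (auto simp: inj_on_def)

section \<open>Cyclic equivalence\<close>

lemma module_series: "Modules.module (\<lambda>c f x. c * (f x :: 'k::field))"
  by unfold_locales (auto simp: fun_eq_iff algebra_simps)

text \<open>A cycle \<open>p1 p2\<close> and its rotation \<open>p2 p1\<close> differ by the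
  commutator of two paths. Up to a given length there are finitely many cycles, which gives a finite
  combination of commutators; the closure takes care of the rest.\<close>

lemma (in fin_digraph) cyclically_equivalent_rotation:
  assumes W: "\<And>u p. W (u, p) \<noteq> 0 \<Longrightarrow> awalk u p u"
    and r: "\<And>u p. W (u, p) \<noteq> 0 \<Longrightarrow> \<exists>p1 p2. p = p1 @ p2 \<and> r (u, p) = (path_end G u p1, p2 @ p1)"
    and len: "\<And>x. length (snd (r x)) = length (snd x)"
  shows "cyclically_equivalent G W (path_map G r W)"
  unfolding cyclically_equivalent_def adic_closure_def
proof (intro CollectI conjI allI)
  have "awalk u p u" if "path_map G r W (u, p) \<noteq> 0" for u p
  proof -
    from that obtain v q where vq: "r (v, q) = (u, p)" "W (v, q) \<noteq> 0"
      by (metis path_map_nonzeroE surj_pair)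
    from r[OF vq(2)] vq(1) obtain p1 p2 where "q = p1 @ p2" "u = path_end G v p1" "p = p2 @ p1"
      by auto
    then show ?thesis using W[OF vq(2)] by (auto simp: path_end_awalk)
  qed
  then show "W - path_map G r W \<in> carrier (path_algebra G)"
    unfolding carrier_path_algebra using W by (auto simp: paths_iff) (metis diff_0 neg_0_equal_iff_equal)
  fix n
  let ?B = "bounded_paths G n"
  define g where "g = (\<Sum>x\<in>?B. (\<lambda>y. W x * (path_elem x - path_elem (r x)) y))"
  have "g \<in> commutator_span G"
    unfolding g_def commutator_span_def
  proof (intro Modules.module.span_sum[OF module_series])
    fix x :: "'a \<times> 'b list"
    obtain u p where x: "x = (u, p)" by fastforce
    show "(\<lambda>y. W x * (path_elem x - path_elem (r x)) y) \<in> Modules.module.span (\<lambda>c f x. c * f x)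
        {path_mult G f g - path_mult G g f | f g.
          f \<in> carrier (path_algebra G) \<and> g \<in> carrier (path_algebra G)}"
    proof (cases "W x = 0")
      case True
      then show ?thesis
        using Modules.module.span_zero[OF module_series] by (simp add: zero_fun_def)
    next
      case False
      then obtain p1 p2 where p: "p = p1 @ p2" "r (u, p) = (path_end G u p1, p2 @ p1)"
        using r x by blast
      have "awalk u (p1 @ p2) u" using W False x p(1) by blast
      then obtain w where w: "awalk u p1 w" "awalk w p2 u" by auto
      have "path_elem x - path_elem (r x) =
          path_mult G (path_elem (u, p1)) (path_elem (w, p2)) -
          path_mult G (path_elem (w, p2)) (path_elem (u, p1))"
        using w x p by (simp add: path_mult_path_elem path_end_awalk)
      moreover have "path_elem (u, p1) \<in> carrier (path_algebra G)" "path_elem (w, p2) \<in> carrier (path_algebra G)"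
        using w by (auto intro!: path_elem_carrier simp: paths_iff)
      ultimately show ?thesis
        by (intro Modules.module.span_scale[OF module_series] Modules.module.span_base[OF module_series]) blast
    qed
  qed
  moreover have "(W - path_map G r W) (u, p) = g (u, p)" if "length p < n" for u p
  proof -
    have bounded: "(u, p) \<in> ?B" if "W (u, p) \<noteq> 0"
      using W[OF that] \<open>length p < n\<close> by (auto simp: bounded_paths_def paths_iff)
    have "(\<Sum>x\<in>?B. W x * path_elem x (u, p)) = (\<Sum>x\<in>?B. if x = (u, p) then W (u, p) else 0)"
      by (rule sum.cong) (auto simp: path_elem_def)
    also have "\<dots> = W (u, p)"
      using bounded by auto
    finally have 1: "(\<Sum>x\<in>?B. W x * path_elem x (u, p)) = W (u, p)" .
    have "(\<Sum>x\<in>?B. W x * path_elem (r x) (u, p)) = (\<Sum>x\<in>{x \<in> ?B. r x = (u, p)}. W x)"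
      by (subst sum.inter_filter) (auto simp: path_elem_def intro!: sum.cong)
    \<comment> \<open>Since \<open>r\<close> keeps lengths, the whole fibre over a short path lies
      among the bounded paths.\<close>
    also have "{x \<in> ?B. r x = (u, p)} = {x \<in> paths G. r x = (u, p)}"
      using len that by (auto simp: bounded_paths_def) (metis less_imp_le snd_conv)
    finally have 2: "(\<Sum>x\<in>?B. W x * path_elem (r x) (u, p)) = path_map G r W (u, p)"
      by (simp add: path_map_def)
    have "g (u, p) = (\<Sum>x\<in>?B. W x * (path_elem x - path_elem (r x)) (u, p))"
      by (simp add: g_def sum_fun_apply)
    then show ?thesis using 1 2 by (simp add: right_diff_distrib sum_subtractf)
  qed
  ultimately show "\<exists>g\<in>commutator_span G. \<forall>u p. length p < n \<longrightarrow>
      (W - path_map G r W) (u, p) = g (u, p)" by blast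
qed

section \<open>Relabelling of arrows\<close>

lemma awalk_map:
  assumes "pre_digraph.awalk G u p v" "verts G = verts H"
    and "\<And>x. x \<in> arcs G \<Longrightarrow> h x \<in> arcs H \<and> tail H (h x) = tail G x \<and> head H (h x) = head G x"
  shows "pre_digraph.awalk H u (map h p) v"
proof -
  have "pre_digraph.cas H u (map h p) v" if "set p \<subseteq> arcs G" "pre_digraph.cas G u p v"
    using that assms(3) by (induction p arbitrary: u) (auto simp: pre_digraph.cas.simps)
  then show ?thesis using assms by (auto simp: pre_digraph.awalk_def)
qed

definition arrow_bij :: "('v, 'f) pre_digraph \<Rightarrow> ('v, 'e) pre_digraph \<Rightarrow> ('f \<Rightarrow> 'e) \<Rightarrow> bool" where
  "arrow_bij Q' Q M \<longleftrightarrow> wf_digraph Q' \<and> wf_digraph Q \<and> verts Q' = verts Q \<and>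
     bij_betw M (arcs Q') (arcs Q) \<and>
     (\<forall>y \<in> arcs Q'. tail Q (M y) = tail Q' y \<and> head Q (M y) = head Q' y)"

text \<open>Coefficients are pulled back, which avoids sums over fibres; hence \<open>M\<close> runs
  against the direction of the algebra map. The value 0 off the paths of \<open>Q'\<close> puts
  every result into the carrier.\<close>

definition relabel :: "('v, 'f) pre_digraph \<Rightarrow> ('f \<Rightarrow> 'e) \<Rightarrow> ('k::field, 'v, 'e) series \<Rightarrow> ('k, 'v, 'f) series" where
  "relabel Q' M f = (\<lambda>(u, q). if (u, q) \<in> paths Q' then f (u, map M q) else 0)"

lemma arrow_bij_inv_into:
  assumes "arrow_bij Q' Q M"
  shows "arrow_bij Q Q' (inv_into (arcs Q') M)"
proof -
  have M: "bij_betw M (arcs Q') (arcs Q)" using assms by (simp add: arrow_bij_def)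
  have "tail Q' (inv_into (arcs Q') M x) = tail Q x \<and> head Q' (inv_into (arcs Q') M x) = head Q x"
    if "x \<in> arcs Q" for x
  proof -
    have "inv_into (arcs Q') M x \<in> arcs Q'" "M (inv_into (arcs Q') M x) = x"
      using bij_betw_inv_into[OF M] bij_betw_inv_into_right[OF M] that by (auto dest: bij_betwE)
    then show ?thesis using assms unfolding arrow_bij_def by metis
  qed
  then show ?thesis using assms by (simp add: arrow_bij_def bij_betw_inv_into)
qed

lemma arrow_bij_awalk:
  "arrow_bij Q' Q M \<Longrightarrow> pre_digraph.awalk Q' u q v \<Longrightarrow> pre_digraph.awalk Q u (map M q) v"
  by (erule awalk_map) (auto simp: arrow_bij_def dest: bij_betwE)

lemma arrow_bij_paths: "arrow_bij Q' Q M \<Longrightarrow> (u, q) \<in> paths Q' \<Longrightarrow> (u, map M q) \<in> paths Q"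
  by (auto simp: paths_def dest: arrow_bij_awalk)

lemma arrow_bij_path_end:
  assumes "arrow_bij Q' Q M" "(u, q) \<in> paths Q'"
  shows "path_end Q u (map M q) = path_end Q' u q"
proof -
  have "wf_digraph Q'" "wf_digraph Q" using assms(1) by (auto simp: arrow_bij_def)
  then show ?thesis
    using assms(2) arrow_bij_awalk[OF assms(1)]
    by (auto simp: paths_def wf_digraph.path_end_awalk)
qed

lemma relabel_add: "relabel Q' M (f + g) = relabel Q' M f + relabel Q' M g"
  by (auto simp: relabel_def fun_eq_iff)

lemma relabel_diff: "relabel Q' M (f - g) = relabel Q' M f - relabel Q' M g"
  by (auto simp: relabel_def fun_eq_iff)

lemma relabel_scale: "relabel Q' M (\<lambda>x. c * f x) = (\<lambda>x. c * relabel Q' M f x)"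
  by (auto simp: relabel_def fun_eq_iff)

lemma relabel_carrier: "relabel Q' M f \<in> carrier (path_algebra Q')"
  by (auto simp: path_algebra_def relabel_def)

lemma relabel_mult:
  fixes Q' :: "('v, 'f) pre_digraph"
  assumes M: "arrow_bij Q' Q M"
  shows "relabel Q' M (path_mult Q f g) = path_mult Q' (relabel Q' M f) (relabel Q' M g)"
proof (rule ext, clarify)
  fix u and q :: "'f list"
  have wf: "wf_digraph Q'" using M by (simp add: arrow_bij_def)
  note app = wf_digraph.paths_append_iff[OF wf, of u "take n q" "drop n q" for n, simplified]
  show "relabel Q' M (path_mult Q f g) (u, q) = path_mult Q' (relabel Q' M f) (relabel Q' M g) (u, q)"
  proof (cases "(u, q) \<in> paths Q'")
    case True
    then show ?thesis
      using app by (auto simp: relabel_def path_mult_def take_map drop_map arrow_bij_path_end[OF M] intro!: sum.cong)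
  next
    case False
    \<comment> \<open>A word that is no path cannot be cut into two composable paths, so every
      product has a zero factor.\<close>
    then have "relabel Q' M f (u, take n q) * relabel Q' M g (path_end Q' u (take n q), drop n q) = 0" for n
      using app[of n] by (auto simp: relabel_def)
    then have "path_mult Q' (relabel Q' M f) (relabel Q' M g) (u, q) = 0"
      by (auto simp: path_mult_def intro!: sum.neutral)
    then show ?thesis using False by (simp add: relabel_def)
  qed
qed

lemma relabel_inverse:
  assumes M: "arrow_bij Q' Q M" and L: "arrow_bij Q Q' L" and LM: "\<And>x. x \<in> arcs Q \<Longrightarrow> M (L x) = x"
    and f: "f \<in> carrier (path_algebra Q)"
  shows "relabel Q L (relabel Q' M f) = f"
proof (rule ext, clarify)
  fix u p
  have wf: "wf_digraph Q" using M by (simp add: arrow_bij_def)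
  show "relabel Q L (relabel Q' M f) (u, p) = f (u, p)"
  proof (cases "(u, p) \<in> paths Q")
    case True
    then have "set p \<subseteq> arcs Q" by (auto simp: paths_def pre_digraph.awalk_def)
    then have "map (M \<circ> L) p = p" by (intro map_idI) (auto simp: LM)
    then show ?thesis using True arrow_bij_paths[OF L True] by (simp add: relabel_def)
  next
    case False
    then show ?thesis using f by (auto simp: relabel_def wf_digraph.carrier_path_algebra[OF wf])
  qed
qed

lemma path_algebra_iso_relabel:
  assumes M: "arrow_bij Q' Q M"
  shows "path_algebra_iso Q Q' (relabel Q' M)"
proof -
  have wf: "wf_digraph Q'" "wf_digraph Q" using M by (auto simp: arrow_bij_def)
  have bM: "bij_betw M (arcs Q') (arcs Q)" and verts: "verts Q' = verts Q"
    using M by (auto simp: arrow_bij_def)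
  note L = arrow_bij_inv_into[OF M]
  have "bij_betw (relabel Q' M) (carrier (path_algebra Q)) (carrier (path_algebra Q'))"
    by (rule bij_betw_byWitness[where f' = "relabel Q (inv_into (arcs Q') M)"])
       (auto simp: relabel_inverse[OF M L] relabel_inverse[OF L M] relabel_carrier
         bij_betw_inv_into_right[OF bM] bij_betw_inv_into_left[OF bM])
  moreover have "relabel Q' M \<one>\<^bsub>path_algebra Q\<^esub> = \<one>\<^bsub>path_algebra Q'\<^esub>"
    using wf verts
    by (auto simp: relabel_def fun_eq_iff wf_digraph.path_algebra_simps wf_digraph.paths_iff
        wf_digraph.awalk_Nil_iff)
  moreover have "relabel Q' M (path_elem (i, [])) = path_elem (i, [])" if "i \<in> verts Q" for i
    using wf verts that
    by (auto simp: relabel_def path_elem_def fun_eq_iff wf_digraph.paths_iff wf_digraph.awalk_Nil_iff)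
  ultimately show ?thesis
    by (auto simp: path_algebra_iso_def ring_iso_def ring_hom_def relabel_carrier
        wf_digraph.path_algebra_simps[OF wf(1)] wf_digraph.path_algebra_simps[OF wf(2)]
        relabel_mult[OF M] relabel_add relabel_scale)
qed

lemma relabel_commutator_span:
  fixes Q' :: "('v, 'f) pre_digraph" and f :: "('k::field, 'v, 'e) series"
  assumes M: "arrow_bij Q' Q M" and f: "f \<in> commutator_span Q"
  shows "relabel Q' M f \<in> commutator_span Q'"
  using f unfolding commutator_span_def
proof (induction rule: Modules.module.span_induct[OF module_series, consumes 1, case_names base step])
  case base
  have "relabel Q' M 0 = (0 :: ('k, 'v, 'f) series)" by (auto simp: relabel_def fun_eq_iff)
  then show ?case
    unfolding Modules.module.subspace_def[OF module_series]
    by (auto simp only: mem_Collect_eq relabel_add relabel_scale simp flip: zero_fun_def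
        intro: Modules.module.span_zero[OF module_series] Modules.module.span_add[OF module_series]
          Modules.module.span_scale[OF module_series])
next
  case (step f)
  then obtain a b where "f = path_mult Q a b - path_mult Q b a" by auto
  then have "relabel Q' M f = path_mult Q' (relabel Q' M a) (relabel Q' M b) -
      path_mult Q' (relabel Q' M b) (relabel Q' M a)"
    by (simp only: relabel_diff relabel_mult[OF M])
  then show ?case
    using relabel_carrier by (intro Modules.module.span_base[OF module_series]) blast
qed

text \<open>Relabelling keeps lengths and maps commutators to commutators, so the approximants can
  be relabelled along with the difference.\<close>

lemma relabel_cyclically_equivalent:
  assumes M: "arrow_bij Q' Q M" and "cyclically_equivalent Q V W"
  shows "cyclically_equivalent Q' (relabel Q' M V) (relabel Q' M W)"
  unfolding cyclically_equivalent_def adic_closure_def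
proof (intro CollectI conjI allI)
  show "relabel Q' M V - relabel Q' M W \<in> carrier (path_algebra Q')"
    by (simp add: relabel_diff[symmetric] relabel_carrier)
  fix n
  obtain g where g: "g \<in> commutator_span Q" "\<And>u p. length p < n \<Longrightarrow> (V - W) (u, p) = g (u, p)"
    using assms(2) unfolding cyclically_equivalent_def adic_closure_def by blast
  have "(relabel Q' M V - relabel Q' M W) (u, p) = relabel Q' M g (u, p)" if "length p < n" for u p
    using g(2)[of "map M p" u] that by (auto simp: relabel_def)
  then show "\<exists>g\<in>commutator_span Q'. \<forall>u p. length p < n \<longrightarrow>
      (relabel Q' M V - relabel Q' M W) (u, p) = g (u, p)"
    using relabel_commutator_span[OF M g(1)] by blast
qed

lemma path_algebra_iso_comp:
  assumes "verts Q = verts Q'" "wf_digraph Q" "path_algebra_iso Q Q' \<phi>" "path_algebra_iso Q' Q'' \<psi>"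
  shows "path_algebra_iso Q Q'' (\<psi> \<circ> \<phi>)"
proof -
  have \<phi>: "\<phi> f \<in> carrier (path_algebra Q')" if "f \<in> carrier (path_algebra Q)" for f
    using that assms(3) by (auto simp: path_algebra_iso_def ring_iso_def ring_hom_def)
  have "\<psi> \<circ> \<phi> \<in> ring_iso (path_algebra Q) (path_algebra Q'')"
    using assms(3,4) by (auto simp: path_algebra_iso_def ring_iso_def intro: ring_hom_trans bij_betw_trans)
  then show ?thesis
    using assms(1,3,4) by (auto simp: path_algebra_iso_def \<phi>)
qed

section \<open>Quivers with a matching\<close>

text \<open>The pre-mutation, the dual quiver and \<open>Q_rho\<close> share their tail and head
  maps, so their walks differ only in the arrows allowed.\<close>

lemma cas_cong:
  "tail G = tail H \<Longrightarrow> head G = head H \<Longrightarrow> pre_digraph.cas G u p v = pre_digraph.cas H u p v"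
  by (induction p arbitrary: u) (auto simp: pre_digraph.cas.simps)

lemma premut_quiver_simps [simp]:
  "verts (premut_quiver Q k) = verts Q"
  "tail (premut_quiver Q k) = mut_tail Q" "head (premut_quiver Q k) = mut_head Q"
  by (auto simp: premut_quiver_def)

lemma dual_quiver_simps [simp]:
  "verts (dual_quiver Q k \<rho>) = verts Q"
  "tail (dual_quiver Q k \<rho>) = mut_tail Q" "head (dual_quiver Q k \<rho>) = mut_head Q"
  by (auto simp: dual_quiver_def)

lemma Q_rho_simps [simp]:
  "verts (Q_rho Q \<rho>) = verts Q" "arcs (Q_rho Q \<rho>) = Old ` Gamma' \<rho> \<union> case_prod Comp ` C' \<rho>"
  "tail (Q_rho Q \<rho>) = mut_tail Q" "head (Q_rho Q \<rho>) = mut_head Q"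
  by (auto simp: Q_rho_def)

text \<open>A left inverse of bracketing, which yields its injectivity. Bracketing produces no
  starred arrow, so the empty list there is only a default.\<close>

primrec unbracket_arrow :: "'e mut_arrow \<Rightarrow> 'e list" where
  "unbracket_arrow (Old a) = [a]"
| "unbracket_arrow (Comp a b) = [a, b]"
| "unbracket_arrow (Star a) = []"

lemma unbracket_bracket_list: "concat (map unbracket_arrow (bracket_list Q k p)) = p"
  by (induction Q k p rule: bracket_list.induct) auto

lemma inj_bracket_list: "inj_on (map_prod id (bracket_list Q k)) A"
proof (rule inj_onI, clarsimp)
  fix p q assume "bracket_list Q k p = bracket_list Q k q"
  then show "p = q" by (metis unbracket_bracket_list)
qed

lemma bracket_list_eq_Nil [simp]: "bracket_list Q k p = [] \<longleftrightarrow> p = []"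
  by (induction Q k p rule: bracket_list.induct) auto

text \<open>Translates admissibility, a condition on subpaths \<alpha>\<beta> of the terms of
  \<open>S\<close>, into the absence of composites in \<open>[S]\<close>.\<close>

lemma Comp_in_bracket_list:
  "Comp a b \<in> set (bracket_list Q k p) \<Longrightarrow> \<exists>p1 p2. p = p1 @ [a, b] @ p2"
proof (induction Q k p rule: bracket_list.induct)
  case (1 Q k x y p)
  show ?case
  proof (cases "(x, y) \<in> C_all Q k")
    case True
    then consider "a = x" "b = y" | "Comp a b \<in> set (bracket_list Q k p)"
      using 1(3) by auto
    then show ?thesis
    proof cases
      case 1
      then have "x # y # p = [] @ [a, b] @ p" by simp
      then show ?thesis by blast
    next
      case 2
      from 1(1)[OF True 2] show ?thesis by (metis append_Cons)
    qed
  next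
    case False
    then have "Comp a b \<in> set (bracket_list Q k (y # p))" using 1(3) by simp
    from 1(2)[OF False this] show ?thesis by (metis append_Cons)
  qed
qed auto

lemma bracket_nonzeroE:
  assumes "bracket Q k W (u, q) \<noteq> 0"
  obtains p where "q = bracket_list Q k p" "(u, p) \<in> paths Q" "W (u, p) \<noteq> 0"
  using assms unfolding bracket_def by (elim path_map_nonzeroE) auto

lemma (in fin_digraph) rotate_off_id:
  assumes "\<And>u p. W (u, p) \<noteq> 0 \<Longrightarrow> (u, p) \<in> paths G \<and> u \<noteq> k"
  shows "rotate_off G k W = W"
proof (rule ext, clarify)
  fix v and q :: "'b list"
  define h where "h = (\<lambda>(u, p). if u = k \<and> p \<noteq> [] then (head G (hd p), rotate1 p) else (u, p))"
  have h: "h x = x" if "W x \<noteq> 0" for x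
    using assms[of "fst x" "snd x"] that by (auto simp: h_def split: prod.splits)
  have "length (snd (h x)) = length (snd x)" for x
    by (auto simp: h_def split: prod.splits)
  \<comment> \<open>Finiteness of the fibre matters: over an infinite one the sum in
    \<open>path_map\<close> would be 0.\<close>
  then have "{x \<in> paths G. h x = (v, q)} \<subseteq> bounded_paths G (length q)"
    by (auto simp: bounded_paths_def) (metis order_refl snd_conv)
  then have fin: "finite {x \<in> paths G. h x = (v, q)}"
    by (rule finite_subset) simp
  have "rotate_off G k W (v, q) = (\<Sum>x\<in>{x \<in> paths G. h x = (v, q)}. if x = (v, q) then W (v, q) else 0)"
    unfolding rotate_off_def path_map_def h_def[symmetric]
    using h by (intro sum.cong) auto
  also have "\<dots> = W (v, q)"
    using assms[of v q] h[of "(v, q)"] fin by auto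
  finally show "rotate_off G k W (v, q) = W (v, q)" .
qed

section \<open>The pre-mutation, the dual quiver and the matched arrows\<close>

locale matched_quiver = fin_digraph Q + loopfree_digraph Q
  for Q :: "('v, 'e) pre_digraph" +
  fixes k :: 'v and \<rho> :: "'e matching"
  assumes no_two_cycle: "two_cycle Q a b \<Longrightarrow> tail Q a \<noteq> k \<and> tail Q b \<noteq> k"
    and matching: "is_matching Q k \<rho>"
begin

abbreviation P :: "('v, 'e mut_arrow) pre_digraph" where "P \<equiv> premut_quiver Q k"
abbreviation D :: "('v, 'e mut_arrow) pre_digraph" where "D \<equiv> dual_quiver Q k \<rho>"
abbreviation R :: "('v, 'e mut_arrow) pre_digraph" where "R \<equiv> Q_rho Q \<rho>"
abbreviation matched_old :: "'e mut_arrow set" where "matched_old \<equiv> Old ` Gamma' \<rho>"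
abbreviation matched_comp :: "'e mut_arrow set" where "matched_comp \<equiv> case_prod Comp ` C' \<rho>"

lemma C_all_iff:
  "(a, b) \<in> C_all Q k \<longleftrightarrow> a \<in> arcs Q \<and> b \<in> arcs Q \<and> head Q a = k \<and> tail Q b = k"
  using no_loops[of a] no_loops[of b] by (auto simp: C_all_def C_ij_def)

lemma finite_C_all [simp]: "finite (C_all Q k)"
  by (rule finite_subset[of _ "arcs Q \<times> arcs Q"]) (auto simp: C_all_iff)

text \<open>The last claim is where the assumption on 2-cycles enters: otherwise \<open>a\<close>
  and \<open>b\<close> would form one through \<open>k\<close>. It keeps composites from being
  loops.\<close>

lemma C_allD:
  assumes "(a, b) \<in> C_all Q k"
  shows "a \<in> arcs Q" "b \<in> arcs Q" "head Q a = k" "tail Q b = k" "tail Q a \<noteq> k" "head Q b \<noteq> k"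
    "tail Q a \<in> verts Q" "head Q b \<in> verts Q" "k \<in> verts Q" "tail Q a \<noteq> head Q b"
proof -
  show *: "a \<in> arcs Q" "b \<in> arcs Q" "head Q a = k" "tail Q b = k" "tail Q a \<noteq> k" "head Q b \<noteq> k"
    "tail Q a \<in> verts Q" "head Q b \<in> verts Q" "k \<in> verts Q"
    using assms no_loops[of a] no_loops[of b] by (auto simp: C_all_iff)
  show "tail Q a \<noteq> head Q b"
    using no_two_cycle[of a b] * by (auto simp: two_cycle_def)
qed

lemma C'_subset: "C' \<rho> \<subseteq> C_all Q k"
  using matching by (simp add: is_matching_def)

lemma finite_C' [simp]: "finite (C' \<rho>)"
  using C'_subset finite_C_all by (rule finite_subset)

lemma Gamma'D:
  assumes "c \<in> Gamma' \<rho>"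
  shows "c \<in> arcs Q" "tail Q c \<noteq> k" "head Q c \<noteq> k" "c \<in> arcs Q - incident Q k"
  using assms matching by (auto simp: is_matching_def Gamma_all_def Gamma_ij_def incident_def)

lemma bij_betw_mate_ij:
  "i \<in> verts Q \<Longrightarrow> i \<noteq> k \<Longrightarrow> j \<in> verts Q \<Longrightarrow> j \<noteq> k \<Longrightarrow>
    bij_betw (mate \<rho>) (C' \<rho> \<inter> C_ij Q k i j) (Gamma' \<rho> \<inter> Gamma_ij Q i j)"
  using matching by (simp add: is_matching_def)

lemma mate:
  assumes "(a, b) \<in> C' \<rho>"
  shows "mate \<rho> (a, b) \<in> Gamma' \<rho>" "tail Q (mate \<rho> (a, b)) = head Q b" "head Q (mate \<rho> (a, b)) = tail Q a"
proof -
  have C: "(a, b) \<in> C_all Q k" using assms C'_subset by blast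
  have "(a, b) \<in> C' \<rho> \<inter> C_ij Q k (tail Q a) (head Q b)"
    using assms C_allD[OF C] by (auto simp: C_ij_def)
  then have "mate \<rho> (a, b) \<in> Gamma' \<rho> \<inter> Gamma_ij Q (tail Q a) (head Q b)"
    using bij_betw_mate_ij[of "tail Q a" "head Q b"] C_allD[OF C] by (blast dest: bij_betwE)
  then show "mate \<rho> (a, b) \<in> Gamma' \<rho>" "tail Q (mate \<rho> (a, b)) = head Q b" "head Q (mate \<rho> (a, b)) = tail Q a"
    by (auto simp: Gamma_ij_def)
qed

text \<open>The bijections are given block by block. A matched arrow determines its block by its
  ends, so two pairs with the same mate lie in one block, where injectivity is known.\<close>

lemma bij_betw_mate: "bij_betw (mate \<rho>) (C' \<rho>) (Gamma' \<rho>)"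
proof (rule bij_betwI')
  fix x y assume x: "x \<in> C' \<rho>" and y: "y \<in> C' \<rho>"
  show "mate \<rho> x = mate \<rho> y \<longleftrightarrow> x = y"
  proof
    assume eq: "mate \<rho> x = mate \<rho> y"
    obtain a b a' b' where xy: "x = (a, b)" "y = (a', b')" by fastforce
    have C: "(a, b) \<in> C_all Q k" "(a', b') \<in> C_all Q k" using x y xy C'_subset by auto
    have "tail Q a = tail Q a'" "head Q b = head Q b'"
      using mate(2,3)[of a b] mate(2,3)[of a' b'] x y xy eq by auto
    then have "x \<in> C' \<rho> \<inter> C_ij Q k (tail Q a) (head Q b)" "y \<in> C' \<rho> \<inter> C_ij Q k (tail Q a) (head Q b)"
      using x y xy C_allD[OF C(1)] C_allD[OF C(2)] by (auto simp: C_ij_def)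
    then show "x = y"
      using bij_betw_mate_ij[of "tail Q a" "head Q b"] C_allD[OF C(1)] eq
      by (auto simp: bij_betw_def dest: inj_onD)
  qed simp
next
  fix x assume "x \<in> C' \<rho>"
  then show "mate \<rho> x \<in> Gamma' \<rho>" using mate(1) by (cases x) auto
next
  fix c assume c: "c \<in> Gamma' \<rho>"
  then have "c \<in> Gamma' \<rho> \<inter> Gamma_ij Q (head Q c) (tail Q c)"
    using Gamma'D by (auto simp: Gamma_ij_def)
  then show "\<exists>x \<in> C' \<rho>. c = mate \<rho> x"
    using bij_betw_mate_ij[of "head Q c" "tail Q c"] Gamma'D[OF c] by (auto simp: bij_betw_def)
qed

lemma mate_pair:
  assumes "c \<in> Gamma' \<rho>" "mate_pair \<rho> c = (a, b)"
  shows "(a, b) \<in> C' \<rho>" "mate \<rho> (a, b) = c" "tail Q c = head Q b" "head Q c = tail Q a"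
proof -
  show *: "(a, b) \<in> C' \<rho>" "mate \<rho> (a, b) = c"
    using bij_betwE[OF bij_betw_inv_into[OF bij_betw_mate]]
      bij_betw_inv_into_right[OF bij_betw_mate assms(1)] assms
    by (auto simp: mate_pair_def simp flip: assms(2))
  show "tail Q c = head Q b" "head Q c = tail Q a" using mate[OF *(1)] *(2) by auto
qed

lemma mate_pair_mate: "x \<in> C' \<rho> \<Longrightarrow> mate_pair \<rho> (mate \<rho> x) = x"
  by (simp add: mate_pair_def bij_betw_inv_into_left[OF bij_betw_mate])

lemma arcs_P:
  "Old a \<in> arcs P \<longleftrightarrow> a \<in> arcs Q \<and> tail Q a \<noteq> k \<and> head Q a \<noteq> k"
  "Comp a b \<in> arcs P \<longleftrightarrow> (a, b) \<in> C_all Q k"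
  "Star a \<in> arcs P \<longleftrightarrow> a \<in> arcs Q \<and> (tail Q a = k \<or> head Q a = k)"
  by (auto simp: premut_quiver_def incident_def)

lemma arcs_D: "arcs D = arcs P - (matched_old \<union> matched_comp)"
  using C'_subset by (auto simp: dual_quiver_def premut_quiver_def)

lemma arcs_R_subset: "arcs R \<subseteq> arcs P"
  using C'_subset Gamma'D by (auto simp: arcs_P)

lemma fin_digraph_P: "fin_digraph P"
proof
  show "tail P e \<in> verts P" "head P e \<in> verts P" if "e \<in> arcs P" for e
    using that by (cases e; auto simp: arcs_P dest: C_allD)+
  show "finite (arcs P)" by (simp add: premut_quiver_def incident_def)
qed simp

lemma fin_digraph_D: "fin_digraph D"
proof -
  interpret P: fin_digraph P by (rule fin_digraph_P)
  show ?thesis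
    using P.tail_in_verts P.head_in_verts P.finite_arcs by unfold_locales (auto simp: arcs_D)
qed

lemma fin_digraph_R: "fin_digraph R"
proof -
  interpret P: fin_digraph P by (rule fin_digraph_P)
  show ?thesis
    using P.tail_in_verts P.head_in_verts finite_subset[OF arcs_R_subset P.finite_arcs] arcs_R_subset
    by unfold_locales (auto simp del: Q_rho_simps(2))
qed

lemma awalk_D_iff:
  "pre_digraph.awalk D u p v \<longleftrightarrow>
    pre_digraph.awalk P u p v \<and> set p \<inter> matched_old = {} \<and> set p \<inter> matched_comp = {}"
  using cas_cong[of D P u p v] by (auto simp: pre_digraph.awalk_def arcs_D)

lemma awalk_R_iff:
  "pre_digraph.awalk R u p v \<longleftrightarrow>
    pre_digraph.awalk P u p v \<and> set p \<subseteq> matched_old \<union> matched_comp"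
proof -
  have "set p \<subseteq> arcs R \<longleftrightarrow> set p \<subseteq> arcs P \<and> set p \<subseteq> matched_old \<union> matched_comp"
    using arcs_R_subset unfolding Q_rho_simps by blast
  then show ?thesis
    using cas_cong[of R P u p v] unfolding pre_digraph.awalk_def by simp blast
qed

text \<open>A walk that enters \<open>k\<close> also leaves it, since it does not end there, and
  this passage is bracketed as a whole; so the bracketed walk never meets \<open>k\<close>. The
  induction is on length because each step consumes one or two arrows.\<close>

lemma bracket_list_awalk:
  assumes "awalk u p v" "u \<noteq> k" "v \<noteq> k"
  shows "pre_digraph.awalk P u (bracket_list Q k p) v"
proof -
  interpret P: fin_digraph P by (rule fin_digraph_P)
  from assms show ?thesis
  proof (induction "length p" arbitrary: u p rule: less_induct)
    case less
    consider "p = []" | a where "p = [a]" | a b q where "p = a # b # q"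
      by (metis neq_Nil_conv)
    then show ?case
    proof cases
      case 1
      then show ?thesis using less.prems by (auto simp: awalk_Nil_iff P.awalk_Nil_iff)
    next
      case 2
      then show ?thesis using less.prems by (auto simp: awalk_simps P.awalk_simps arcs_P)
    next
      case 3
      then have w: "a \<in> arcs Q" "tail Q a = u" "b \<in> arcs Q" "tail Q b = head Q a" "awalk (head Q b) q v"
        using less.prems by (auto simp: awalk_Cons_iff)
      show ?thesis
      proof (cases "(a, b) \<in> C_all Q k")
        case True
        then have "P.awalk (head Q b) (bracket_list Q k q) v"
          using less.hyps[of q "head Q b"] 3 w less.prems C_allD[OF True] by auto
        then show ?thesis using True 3 w by (simp add: P.awalk_Cons_iff arcs_P)
      next
        case False
        then have "head Q a \<noteq> k" using w by (auto simp: C_all_iff)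
        moreover from this have "P.awalk (head Q a) (bracket_list Q k (b # q)) v"
          using less.hyps[of "b # q" "head Q a"] 3 w less.prems by (auto simp: awalk_Cons_iff)
        ultimately show ?thesis using False 3 w less.prems by (simp add: P.awalk_Cons_iff arcs_P)
      qed
    qed
  qed
qed

text \<open>A cycle could shrink to a single composite only if \<alpha>\<beta> were itself closed,
  that is, a 2-cycle through \<open>k\<close>. This makes \<open>[S]\<close> a potential
  again.\<close>

lemma length_bracket_list:
  assumes "awalk u p u" "2 \<le> length p"
  shows "2 \<le> length (bracket_list Q k p)"
proof -
  obtain a b q where p: "p = a # b # q"
    using assms(2) by (metis Suc_le_length_iff numeral_2_eq_2)
  show ?thesis
  proof (cases "(a, b) \<in> C_all Q k")
    case True
    have "q \<noteq> []"
      using C_allD(10)[OF True] assms(1) p by (auto simp: awalk_simps)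
    then have "length (bracket_list Q k q) > 0" by simp
    then show ?thesis using p True by (simp add: Suc_le_eq)
  next
    case False
    have "length (bracket_list Q k (b # q)) > 0" by (simp del: bracket_list.simps)
    then show ?thesis using p False by (simp add: Suc_le_eq)
  qed
qed

end

section \<open>Paths avoiding a set of arrows\<close>

definition restrict_avoiding :: "'e set \<Rightarrow> ('k::field, 'v, 'e) series \<Rightarrow> ('k, 'v, 'e) series" where
  "restrict_avoiding Y f = (\<lambda>(u, p). if set p \<inter> Y = {} then f (u, p) else 0)"

text \<open>Paths that meet \<open>Y\<close> span a two-sided ideal, so dropping them is compatible
  with products.\<close>

lemma path_mult_restrict_avoiding:
  fixes f g :: "('k::field, 'v, 'e) series"
  shows "path_mult G (restrict_avoiding Y f) (restrict_avoiding Y g) = restrict_avoiding Y (path_mult G f g)"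
proof (rule ext, clarify)
  fix u and p :: "'e list"
  have "set p = set (take n p) \<union> set (drop n p)" for n
    by (metis append_take_drop_id set_append)
  then have "restrict_avoiding Y f (u, take n p) * restrict_avoiding Y g (path_end G u (take n p), drop n p) =
      (if set p \<inter> Y = {} then f (u, take n p) * g (path_end G u (take n p), drop n p) else 0)" for n
    by (auto simp: restrict_avoiding_def)
  then show "path_mult G (restrict_avoiding Y f) (restrict_avoiding Y g) (u, p) =
      restrict_avoiding Y (path_mult G f g) (u, p)"
    by (simp add: path_mult_def) (simp add: restrict_avoiding_def)
qed

lemma path_mult_scale:
  "path_mult G (\<lambda>y. c * f y) (\<lambda>y. d * g y) = (\<lambda>y. c * d * path_mult G f g y)"
  by (auto simp: path_mult_def fun_eq_iff sum_distrib_left mult_ac)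

lemma (in fin_digraph) subst_path_avoiding:
  assumes s: "\<And>x u p. x \<notin> Y \<Longrightarrow> s x (u, p) \<noteq> 0 \<Longrightarrow> set p \<inter> Y = {}"
    and "set p \<inter> Y = {}" "subst_path G s u p (w, q) \<noteq> 0"
  shows "set q \<inter> Y = {}"
  using assms(2,3)
proof (induction p arbitrary: u w q)
  case Nil
  then show ?case by (auto simp: path_elem_def split: if_splits)
next
  case (Cons x p)
  from Cons.prems(2) obtain q1 q2 where q: "q = q1 @ q2" "s x (w, q1) \<noteq> 0"
    "subst_path G s (head G x) p (path_end G w q1, q2) \<noteq> 0"
    by (auto simp: path_mult_sum_splits elim!: sum.not_neutral_contains_not_neutral)
  have "set q1 \<inter> Y = {}" using s[of x w q1] q(2) Cons.prems(1) by simp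
  moreover have "set q2 \<inter> Y = {}" using Cons.IH[OF _ q(3)] Cons.prems(1) by simp
  ultimately show ?case using q(1) by auto
qed

section \<open>Substituting for the matched old arrows\<close>

context matched_quiver
begin

sublocale P: fin_digraph P by (rule fin_digraph_P)

text \<open>Phrased through \<open>subst_arrow\<close>, so that modulo the matched old arrows the
  image of \<gamma> is literally the signed replacement used in \<open>S_star\<close>.\<close>

definition old_shift :: "'e mut_arrow \<Rightarrow> ('k::field, 'v, 'e mut_arrow) series" where
  "old_shift y = - path_elem (mut_tail Q y, subst_arrow \<rho> y)"

definition subst_old :: "'e mut_arrow \<Rightarrow> ('k::field, 'v, 'e mut_arrow) series" where
  "subst_old = shift_arrows P matched_old old_shift"

lemma matched_comp_subset: "matched_comp \<subseteq> arcs P"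
  using C'_subset by (auto simp: arcs_P)

lemma matched_old_subset: "matched_old \<subseteq> arcs P"
  using Gamma'D by (auto simp: arcs_P)

lemma subst_arrow_awalk:
  assumes "y \<in> arcs P"
  shows "P.awalk (mut_tail Q y) (subst_arrow \<rho> y) (mut_head Q y)"
proof (cases "y \<in> matched_old")
  case True
  then obtain c where c: "y = Old c" "c \<in> Gamma' \<rho>" by auto
  obtain a b where ab: "mate_pair \<rho> c = (a, b)" by fastforce
  note m = mate_pair[OF c(2) ab]
  have "(a, b) \<in> C_all Q k" using m(1) C'_subset by auto
  note this C_allD[OF this]
  then show ?thesis using c ab m by (auto simp: subst_arrow_def P.awalk_simps arcs_P)
next
  case False
  then show ?thesis
    using assms P.tail_in_verts[OF assms] P.head_in_verts[OF assms]
    by (simp add: subst_arrow_def P.awalk_simps)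
qed

lemma subst_arrow_avoiding:
  "set (subst_arrow \<rho> y) \<inter> matched_old = {}"
  "y \<notin> matched_comp \<Longrightarrow> set (subst_arrow \<rho> y) \<inter> matched_comp = {}"
  "subst_arrow \<rho> y \<noteq> []"
  by (auto simp: subst_arrow_def split: prod.splits if_splits)

lemma old_shift:
  assumes "y \<in> matched_old" "y \<in> arcs P" "old_shift y (u, p) \<noteq> (0 :: 'k::field)"
  shows "u = tail P y \<and> p \<noteq> [] \<and> P.awalk u p (head P y) \<and> set p \<inter> matched_old = {}"
  using assms subst_arrow_awalk[OF assms(2)] subst_arrow_avoiding(1,3)[of y]
  by (auto simp: old_shift_def path_elem_def split: if_splits)

lemma is_subst_old: "is_subst P subst_old"
  unfolding subst_old_def by (rule P.shift_arrows_iso(1)[OF old_shift])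

lemma path_algebra_iso_subst_old: "path_algebra_iso P P (subst_series P subst_old)"
  unfolding subst_old_def by (rule P.shift_arrows_iso(2)[OF old_shift])

lemma restrict_subst_old:
  "restrict_avoiding matched_old (subst_old y) =
    (\<lambda>z. (if y \<in> matched_old then - 1 else 1) * path_elem (mut_tail Q y, subst_arrow \<rho> y) z)"
proof (cases "y \<in> matched_old")
  case True
  then show ?thesis
    using subst_arrow_avoiding(1)[of y]
    by (auto simp: restrict_avoiding_def subst_old_def shift_arrows_def old_shift_def path_elem_def fun_eq_iff)
next
  case False
  then show ?thesis
    by (auto simp: restrict_avoiding_def subst_old_def shift_arrows_def subst_arrow_def path_elem_def fun_eq_iff)
qed

text \<open>The projection is multiplicative, so single arrows suffice: each \<gamma> loses its
  unshifted summand and keeps only -\<beta>*\<alpha>*, which gives one sign per matched old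
  arrow.\<close>

lemma restrict_subst_path_old:
  assumes "P.awalk u p v"
  shows "restrict_avoiding matched_old (subst_path P subst_old u p) =
    (\<lambda>y. (- 1) ^ length (filter (\<lambda>x. x \<in> matched_old) p) *
      path_elem (u, concat (map (subst_arrow \<rho>) p)) y)"
  using assms
proof (induction p arbitrary: u)
  case Nil
  then show ?case by (auto simp: restrict_avoiding_def path_elem_def fun_eq_iff)
next
  case (Cons x p)
  then have x: "x \<in> arcs P" "mut_tail Q x = u" and p: "P.awalk (mut_head Q x) p v"
    by (auto simp: P.awalk_Cons_iff)
  have "path_end P u (subst_arrow \<rho> x) = mut_head Q x"
    using P.path_end_awalk[OF subst_arrow_awalk[OF x(1)]] x(2) by simp
  then have *: "path_mult P (path_elem (u, subst_arrow \<rho> x)) (path_elem (mut_head Q x, q)) =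
      path_elem (u, subst_arrow \<rho> x @ q)" for q
    by (rule P.path_mult_path_elem)
  show ?case
    by (simp add: path_mult_restrict_avoiding[symmetric] restrict_subst_old Cons.IH[OF p]
        path_mult_scale x(2) *)
qed

text \<open>Identifies \<open>S_star\<close> as the part of the substituted \<open>[S]\<close>
  without matched old arrows; what remains is left for the second substitution to absorb.\<close>

lemma S_star_eq:
  fixes S :: "('k::field, 'v, 'e) series"
  shows "S_star Q k \<rho> S = restrict_avoiding matched_old (subst_series P subst_old (bracket Q k S))"
proof (rule ext, clarify)
  fix v and q :: "'e mut_arrow list"
  define B where "B = bounded_paths P (length q)"
  define h where "h = map_prod (id :: 'v \<Rightarrow> 'v) (\<lambda>q. concat (map (subst_arrow \<rho>) q))"
  define sgn where "sgn = (\<lambda>p. (- 1 :: 'k) ^ length (filter (\<lambda>x. x \<in> matched_old) p))"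
  have len: "length p \<le> length (concat (map (subst_arrow \<rho>) p))" for p
  proof (induction p)
    case (Cons x p)
    then show ?case using subst_arrow_avoiding(3)[of x] by (cases "subst_arrow \<rho> x") auto
  qed simp
  have "restrict_avoiding matched_old (subst_series P subst_old (bracket Q k S)) (v, q) =
      (\<Sum>x\<in>B. bracket Q k S x * restrict_avoiding matched_old (subst_path P subst_old (fst x) (snd x)) (v, q))"
    by (simp add: restrict_avoiding_def subst_series_def B_def)
  also have "\<dots> = (\<Sum>x\<in>B. if h x = (v, q) then sgn (snd x) * bracket Q k S x else 0)"
  proof (rule sum.cong)
    fix x assume "x \<in> B"
    then obtain w where "P.awalk (fst x) (snd x) w"
      by (cases x) (auto simp: B_def bounded_paths_def P.paths_iff)
    note * = restrict_subst_path_old[OF this]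
    show "bracket Q k S x * restrict_avoiding matched_old (subst_path P subst_old (fst x) (snd x)) (v, q) =
        (if h x = (v, q) then sgn (snd x) * bracket Q k S x else 0)"
      unfolding * by (cases x) (auto simp: h_def sgn_def path_elem_def)
  qed simp
  also have "\<dots> = (\<Sum>x\<in>{x \<in> B. h x = (v, q)}. sgn (snd x) * bracket Q k S x)"
    by (rule sum.inter_filter[symmetric]) (simp add: B_def)
  \<comment> \<open>Replacing arrows by nonempty lists never shortens a path, so the cutoff
    \<open>B\<close> loses no preimage.\<close>
  also have "{x \<in> B. h x = (v, q)} = {x \<in> paths P. h x = (v, q)}"
    using len by (auto simp: B_def bounded_paths_def h_def)
  also have "(\<Sum>x\<in>\<dots>. sgn (snd x) * bracket Q k S x) = S_star Q k \<rho> S (v, q)"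
    by (simp add: S_star_def path_map_def h_def sgn_def case_prod_unfold)
  finally show "S_star Q k \<rho> S (v, q) =
      restrict_avoiding matched_old (subst_series P subst_old (bracket Q k S)) (v, q)" by simp
qed

definition rho_cycle :: "'e \<times> 'e \<Rightarrow> ('k::field, 'v, 'e mut_arrow) series" where
  "rho_cycle x = path_elem (tail Q (fst x), [Comp (fst x) (snd x), Old (mate \<rho> x)])"

lemma matched_triangle:
  assumes "(a, b) \<in> C' \<rho>"
  shows "awalk (tail Q a) [a, b, mate \<rho> (a, b)] (tail Q a)"
    and "P.awalk (tail Q a) [Comp a b, Old (mate \<rho> (a, b))] (tail Q a)"
proof -
  have C: "(a, b) \<in> C_all Q k" using assms C'_subset by auto
  show "awalk (tail Q a) [a, b, mate \<rho> (a, b)] (tail Q a)"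
    "P.awalk (tail Q a) [Comp a b, Old (mate \<rho> (a, b))] (tail Q a)"
    using C_allD[OF C] mate[OF assms] Gamma'D[OF mate(1)[OF assms]] C
    by (auto simp: awalk_simps P.awalk_simps arcs_P)
qed

lemma W_rho_support:
  assumes "W_rho Q \<rho> (u, p) \<noteq> (0 :: 'k::field)"
  obtains a b where "(a, b) \<in> C' \<rho>" "u = tail Q a" "p = [a, b, mate \<rho> (a, b)]"
  using assms unfolding W_rho_def sum_fun_apply
  by (elim sum.not_neutral_contains_not_neutral) (auto simp: path_elem_def split: if_splits)

lemma bracket_W_rho: "bracket Q k (W_rho Q \<rho>) = (\<Sum>x\<in>C' \<rho>. rho_cycle x)"
proof -
  have "bracket Q k (path_elem (tail Q a, [a, b, mate \<rho> (a, b)])) = rho_cycle (a, b)"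
    if "(a, b) \<in> C' \<rho>" for a b
    using matched_triangle(1)[OF that] that C'_subset
    by (subst bracket_def, subst path_map_path_elem[OF inj_bracket_list])
       (auto simp: paths_iff rho_cycle_def)
  then show ?thesis
    unfolding W_rho_def bracket_def path_map_sum by (intro sum.cong) (auto simp: bracket_def)
qed

lemma star_cycle_awalk:
  assumes "(a, b) \<in> C_all Q k"
  shows "P.awalk (tail Q a) [Comp a b, Star b, Star a] (tail Q a)"
  using C_allD[OF assms] assms by (auto simp: P.awalk_simps arcs_P)

lemma star_cycle_sum_support:
  assumes "(\<Sum>c\<in>A. star_cycle Q c) (u, p) \<noteq> (0 :: 'k::field)"
  obtains a b where "(a, b) \<in> A" "u = tail Q a" "p = [Comp a b, Star b, Star a]"
  using assms unfolding sum_fun_apply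
  by (elim sum.not_neutral_contains_not_neutral) (auto simp: path_elem_def star_cycle_def split: if_splits)

lemma rho_cycle_sum_support:
  assumes "(\<Sum>c\<in>C' \<rho>. rho_cycle c) (u, p) \<noteq> (0 :: 'k::field)"
  obtains a b where "(a, b) \<in> C' \<rho>" "u = tail Q a" "p = [Comp a b, Old (mate \<rho> (a, b))]"
  using assms unfolding sum_fun_apply
  by (elim sum.not_neutral_contains_not_neutral) (auto simp: path_elem_def rho_cycle_def split: if_splits)

end

section \<open>Terms with matched old arrows and their absorption\<close>

locale matched_potential = matched_quiver Q k \<rho>
  for Q :: "('v, 'e) pre_digraph" and k :: 'v and \<rho> :: "'e matching" +
  fixes S :: "('k::field, 'v, 'e) series"
  assumes admissible: "is_admissible Q k \<rho> S"
begin

definition substituted :: "('k, 'v, 'e mut_arrow) series" where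
  "substituted = subst_series P subst_old (bracket Q k S)"

text \<open>By \<open>S_star_eq\<close> these are the terms of \<open>substituted\<close> in which a
  matched old arrow survives.\<close>

definition residue :: "('k, 'v, 'e mut_arrow) series" where
  "residue = substituted - S_star Q k \<rho> S"

text \<open>The \<open>Suc\<close> puts the cut directly behind the first matched old arrow, which
  thereby becomes the last one.\<close>

definition rot :: "('v, 'e mut_arrow) path \<Rightarrow> ('v, 'e mut_arrow) path" where
  "rot = (\<lambda>(u, q). let n = Suc (length (takeWhile (\<lambda>x. x \<notin> matched_old) q)) in
     (path_end P u (take n q), drop n q @ take n q))"

text \<open>
  Every term of \<open>rotated\<close> ends with a matched old arrow, so \<open>rotated\<close> is the sum over \<open>C'\<close> of the products
  of \<open>- comp_shift [ab]\<close> with the arrow matched to \<open>(a, b)\<close>.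
\<close>

definition rotated :: "('k, 'v, 'e mut_arrow) series" where
  "rotated = path_map P rot residue"

text \<open>Stripping the last arrow turns the part of \<open>rotated\<close> that ends in \<gamma>
  into \<open>T\<^sub>\<gamma>\<close>, and the sign makes the shift subtract it. The zero clauses
  are defaults, as only matched composites are shifted.\<close>

primrec comp_shift :: "'e mut_arrow \<Rightarrow> ('k, 'v, 'e mut_arrow) series" where
  "comp_shift (Old a) = 0"
| "comp_shift (Comp a b) = (\<lambda>(u, q). - rotated (u, q @ [Old (mate \<rho> (a, b))]))"
| "comp_shift (Star a) = 0"

definition subst_comp :: "'e mut_arrow \<Rightarrow> ('k, 'v, 'e mut_arrow) series" where
  "subst_comp = shift_arrows P matched_comp comp_shift"

lemma S_support:
  assumes "S (u, p) \<noteq> 0"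
  shows "awalk u p u" "2 \<le> length p" "u \<noteq> k"
    "(a, b) \<in> C' \<rho> \<Longrightarrow> p \<noteq> p1 @ [a, b] @ p2"
  using assms admissible unfolding is_admissible_def is_potential_def by blast+

lemma bracket_S_support:
  assumes "bracket Q k S (u, q) \<noteq> 0"
  shows "P.awalk u q u" "2 \<le> length q" "set q \<inter> matched_comp = {}"
proof -
  obtain p where p: "q = bracket_list Q k p" "S (u, p) \<noteq> 0"
    using assms by (elim bracket_nonzeroE)
  note S = S_support[OF p(2)]
  show "P.awalk u q u" using bracket_list_awalk[OF S(1,3,3)] p(1) by simp
  show "2 \<le> length q" using length_bracket_list[OF S(1,2)] p(1) by simp
  have False if "(a, b) \<in> C' \<rho>" "Comp a b \<in> set q" for a b
    using Comp_in_bracket_list[of a b Q k p] S(4)[OF that(1)] that(2) p(1) by blast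
  then show "set q \<inter> matched_comp = {}" by auto
qed

text \<open>The first substitution introduces starred arrows only, so a matched composite would have
  to occur in \<open>[S]\<close> already, which admissibility excludes.\<close>

lemma substituted_support:
  assumes "substituted (u, q) \<noteq> 0"
  shows "P.awalk u q u" "2 \<le> length q" "set q \<inter> matched_comp = {}"
proof -
  obtain x where "bracket Q k S x \<noteq> 0" "subst_path P subst_old (fst x) (snd x) (u, q) \<noteq> (0 :: 'k)"
    using assms unfolding substituted_def subst_series_def
    by (auto elim!: sum.not_neutral_contains_not_neutral)
  then obtain v p where p: "bracket Q k S (v, p) \<noteq> 0" "subst_path P subst_old v p (u, q) \<noteq> (0 :: 'k)"
    by (cases x) auto
  note b = bracket_S_support[OF p(1)]
  note s = P.subst_path_support[OF is_subst_old b(1) p(2)]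
  show "P.awalk u q u" "2 \<le> length q" using s b(2) by auto
  show "set q \<inter> matched_comp = {}"
  proof (rule P.subst_path_avoiding[OF _ b(3) p(2)])
    fix x u p assume "x \<notin> matched_comp" "subst_old x (u, p) \<noteq> (0 :: 'k)"
    then show "set p \<inter> matched_comp = {}"
      using subst_arrow_avoiding(2)[of x]
      by (auto simp: subst_old_def shift_arrows_def old_shift_def path_elem_def split: if_splits)
  qed
qed

lemma S_star_support:
  assumes "S_star Q k \<rho> S (u, q) \<noteq> 0"
  shows "pre_digraph.awalk D u q u" "2 \<le> length q"
  using assms substituted_support[of u q]
  by (auto simp: S_star_eq substituted_def restrict_avoiding_def awalk_D_iff split: if_splits)

lemma residue_support:
  assumes "residue (u, q) \<noteq> 0"
  shows "P.awalk u q u" "2 \<le> length q" "set q \<inter> matched_comp = {}" "set q \<inter> matched_old \<noteq> {}"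
  using assms substituted_support[of u q]
  by (auto simp: residue_def S_star_eq substituted_def restrict_avoiding_def split: if_splits)

lemma rot_residue:
  assumes "residue (u, q) \<noteq> 0"
  obtains p1 p2 c where "q = p1 @ Old c # p2" "c \<in> Gamma' \<rho>"
    "rot (u, q) = (path_end P u (p1 @ [Old c]), p2 @ p1 @ [Old c])"
proof -
  obtain p1 p2 x where q: "q = p1 @ x # p2" "x \<in> matched_old" "\<forall>y \<in> set p1. y \<notin> matched_old"
    using residue_support(4)[OF assms] split_list_first_prop[of q "\<lambda>x. x \<in> matched_old"] by blast
  have "takeWhile (\<lambda>x. x \<notin> matched_old) q = p1"
    using q by (simp add: takeWhile_append)
  then have "rot (u, q) = (path_end P u (p1 @ [x]), p2 @ p1 @ [x])"
    using q(1) by (simp add: rot_def Let_def)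
  then show ?thesis using that q by blast
qed

lemma cyclically_equivalent_residue: "cyclically_equivalent P residue rotated"
  unfolding rotated_def
proof (rule P.cyclically_equivalent_rotation)
  show "P.awalk u p u" if "residue (u, p) \<noteq> 0" for u p
    using residue_support(1)[OF that] .
  show "\<exists>p1 p2. p = p1 @ p2 \<and> rot (u, p) = (path_end P u p1, p2 @ p1)" if nz: "residue (u, p) \<noteq> 0" for u p
  proof -
    obtain p1 p2 c where "p = p1 @ Old c # p2" "rot (u, p) = (path_end P u (p1 @ [Old c]), p2 @ p1 @ [Old c])"
      using nz by (elim rot_residue)
    then show ?thesis by (intro exI[of _ "p1 @ [Old c]"] exI[of _ p2]) simp
  qed
  show "length (snd (rot x)) = length (snd x)" for x
    by (cases x) (simp add: rot_def Let_def)
qed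

text \<open>\<open>r\<close> is nonempty because every term of \<open>residue\<close> has length at
  least 2. Hence \<open>comp_shift\<close> has no constant term, as a substitution requires.\<close>

lemma rotated_support:
  assumes "rotated (u, q) \<noteq> 0"
  obtains r c where "q = r @ [Old c]" "c \<in> Gamma' \<rho>" "P.awalk u q u" "r \<noteq> []"
    "set q \<inter> matched_comp = {}"
proof -
  obtain v p where p: "rot (v, p) = (u, q)" "residue (v, p) \<noteq> 0"
    using assms unfolding rotated_def by (auto elim: path_map_nonzeroE)
  obtain p1 p2 c where c: "p = p1 @ Old c # p2" "c \<in> Gamma' \<rho>"
    "rot (v, p) = (path_end P v (p1 @ [Old c]), p2 @ p1 @ [Old c])"
    using p(2) by (elim rot_residue)
  have q: "q = (p2 @ p1) @ [Old c]" "u = path_end P v (p1 @ [Old c])" using p(1) c(3) by auto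
  note r = residue_support[OF p(2)]
  have "P.awalk v ((p1 @ [Old c]) @ p2) v" using r(1) c(1) by simp
  then obtain w where w: "P.awalk v (p1 @ [Old c]) w" "P.awalk w p2 v"
    unfolding P.awalk_append_iff[of v "p1 @ [Old c]" p2] by blast
  then have "u = w" using q(2) P.path_end_awalk[OF w(1)] by simp
  then have "P.awalk u q u"
    using w q(1) P.awalk_appendI[OF w(2,1)] by simp
  moreover have "p2 @ p1 \<noteq> []" using r(2) c(1) by (cases p1; cases p2) auto
  moreover have "set q \<inter> matched_comp = {}" using r(3) c(1) q(1) by auto
  ultimately show ?thesis using that q(1) c(2) by blast
qed

text \<open>The closed walk \<open>q\<close> followed by \<gamma> starts where \<gamma> ends.
  Removing \<gamma> leaves a walk from the head of \<gamma> to its tail, which is parallel to the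
  composite matched with \<gamma>.\<close>

lemma comp_shift:
  assumes "y \<in> matched_comp" "comp_shift y (u, q) \<noteq> 0"
  shows "u = tail P y \<and> q \<noteq> [] \<and> P.awalk u q (head P y) \<and> set q \<inter> matched_comp = {}"
proof -
  obtain a b where ab: "y = Comp a b" "(a, b) \<in> C' \<rho>" using assms(1) by auto
  have nz: "rotated (u, q @ [Old (mate \<rho> (a, b))]) \<noteq> 0" using assms(2) ab(1) by simp
  have *: "P.awalk u (q @ [Old (mate \<rho> (a, b))]) u" "q \<noteq> []" "set q \<inter> matched_comp = {}"
    using nz by (auto elim!: rotated_support)
  then have "P.awalk u q (head Q b)" "u = tail Q a"
    using mate[OF ab(2)] by (auto simp: P.awalk_simps)
  then show ?thesis using * ab(1) by simp
qed

lemma is_subst_comp: "is_subst P subst_comp"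
  unfolding subst_comp_def by (rule P.shift_arrows_iso(1)[OF comp_shift])

lemma path_algebra_iso_subst_comp: "path_algebra_iso P P (subst_series P subst_comp)"
  unfolding subst_comp_def by (rule P.shift_arrows_iso(2)[OF comp_shift])

lemma subst_old_star_cycle:
  "c \<in> C_all Q k \<Longrightarrow> subst_series P subst_old (star_cycle Q c) = (star_cycle Q c :: ('k, _, _) series)"
proof (cases c, rule P.subst_series_fixed)
  fix a b assume c: "c = (a, b)" "c \<in> C_all Q k"
  then show "star_cycle Q c \<in> carrier (path_algebra P)"
    using star_cycle_awalk[of a b] by (auto simp: star_cycle_def P.paths_iff intro!: P.path_elem_carrier)
qed (auto simp: star_cycle_def path_elem_def subst_old_def shift_arrows_def split: if_splits)

text \<open>The image is [\<alpha>\<beta>] times \<gamma> - \<beta>*\<alpha>*; its second term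
  cancels the corresponding star cycle of the pre-mutated potential.\<close>

lemma subst_old_rho_cycle:
  assumes "x \<in> C' \<rho>"
  shows "subst_series P subst_old (rho_cycle x) = (rho_cycle x - star_cycle Q x :: ('k, _, _) series)"
proof -
  obtain a b where x: "x = (a, b)" by fastforce
  have ab: "(a, b) \<in> C' \<rho>" "(a, b) \<in> C_all Q k" using assms x C'_subset by auto
  define m where "m = mate \<rho> (a, b)"
  note m = mate[OF ab(1), folded m_def] and C = C_allD[OF ab(2)]
  have path: "(tail Q a, [Comp a b, Old m]) \<in> paths P"
    using matched_triangle(2)[OF ab(1)] by (auto simp: P.paths_iff m_def)
  have "subst_arrow \<rho> (Old m) = [Star b, Star a]"
    using m(1) mate_pair_mate[OF ab(1), folded m_def] by (simp add: subst_arrow_def)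
  then have Old: "subst_old (Old m) =
      (path_elem (head Q b, [Old m]) - path_elem (head Q b, [Star b, Star a]) :: ('k, _, _) series)"
    using m by (simp add: subst_old_def shift_arrows_def old_shift_def)
  have Comp: "subst_old (Comp a b) = (path_elem (tail Q a, [Comp a b]) :: ('k, _, _) series)"
    by (auto simp: subst_old_def shift_arrows_def)
  have "subst_series P subst_old (rho_cycle x) =
      (path_mult P (path_elem (tail Q a, [Comp a b]))
        (path_mult P (path_elem (head Q b, [Old m]) - path_elem (head Q b, [Star b, Star a]))
          (path_elem (tail Q a, []))) :: ('k, _, _) series)"
    using m x Old Comp
    by (simp add: rho_cycle_def m_def[symmetric] P.subst_series_path_elem[OF is_subst_old path])
  also have "\<dots> = rho_cycle x - star_cycle Q x"
    using m C x
    by (simp add: P.path_mult_diff_left P.path_mult_diff_right P.path_mult_path_elem rho_cycle_def star_cycle_def m_def[symmetric])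
  finally show ?thesis .
qed

lemma subst_comp_fixed:
  assumes "f \<in> carrier (path_algebra P)" "\<And>u p. f (u, p) \<noteq> 0 \<Longrightarrow> set p \<inter> matched_comp = {}"
  shows "subst_series P subst_comp f = f"
proof (rule P.subst_series_fixed[OF assms(1)])
  fix u p x assume "f (u, p) \<noteq> 0" "x \<in> set p"
  then have "x \<notin> matched_comp" using assms(2) by blast
  then show "subst_comp x = path_elem (tail P x, [x])" by (simp add: subst_comp_def shift_arrows_def)
qed

text \<open>Multiplying the shift by \<gamma> restores the arrow that was stripped from
  \<open>rotated\<close>, so the added series is minus the part of \<open>rotated\<close> ending in
  \<gamma>.\<close>

lemma subst_comp_rho_cycle:
  assumes "x \<in> C' \<rho>"
  shows "subst_series P subst_comp (rho_cycle x) =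
    rho_cycle x + (\<lambda>(v, q). if \<exists>r. q = r @ [Old (mate \<rho> x)] then - rotated (v, q) else 0)"
proof -
  obtain a b where x: "x = (a, b)" by fastforce
  have ab: "(a, b) \<in> C' \<rho>" "(a, b) \<in> C_all Q k" using assms x C'_subset by auto
  define m where "m = mate \<rho> (a, b)"
  note m = mate[OF ab(1), folded m_def] and C = C_allD[OF ab(2)]
  have path: "(tail Q a, [Comp a b, Old m]) \<in> paths P"
    using matched_triangle(2)[OF ab(1)] by (auto simp: P.paths_iff m_def)
  have ends: "path_end P v q = head Q b" if "comp_shift (Comp a b) (v, q) \<noteq> 0" for v q
    using comp_shift[OF _ that] ab(1) P.path_end_awalk by auto
  have Old: "subst_comp (Old m) = path_elem (head Q b, [Old m])"
    using m by (auto simp: subst_comp_def shift_arrows_def)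
  have Comp: "subst_comp (Comp a b) = path_elem (tail Q a, [Comp a b]) + comp_shift (Comp a b)"
    using ab(1) by (force simp: subst_comp_def shift_arrows_def)
  have "subst_series P subst_comp (rho_cycle x) =
      path_mult P (path_elem (tail Q a, [Comp a b]) + comp_shift (Comp a b))
        (path_mult P (path_elem (head Q b, [Old m])) (path_elem (tail Q a, [])))"
    using m x Old Comp
    by (simp add: rho_cycle_def m_def[symmetric] P.subst_series_path_elem[OF is_subst_comp path])
  also have "\<dots> = path_elem (tail Q a, [Comp a b, Old m]) +
      path_mult P (comp_shift (Comp a b)) (path_elem (head Q b, [Old m]))"
    using m by (simp add: P.path_mult_path_elem P.path_mult_add_left del: comp_shift.simps)
  also have "path_mult P (comp_shift (Comp a b)) (path_elem (head Q b, [Old m])) =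
      (\<lambda>(v, q). if \<exists>r. q = r @ [Old (mate \<rho> x)] then - rotated (v, q) else 0)"
    by (subst fun_eq_iff, clarify, subst P.path_mult_path_elem_right[OF ends])
       (auto simp: x m_def)
  finally show ?thesis using x by (simp add: rho_cycle_def m_def fun_eq_iff)
qed

text \<open>Every term of \<open>rotated\<close> ends in a matched old arrow, and since
  \<open>mate\<close> is injective on \<open>C'\<close> exactly one summand picks it up.\<close>

lemma rotated_eq_sum:
  "(\<Sum>x\<in>C' \<rho>. (\<lambda>(v, q). if \<exists>r. q = r @ [Old (mate \<rho> x)] then - rotated (v, q) else 0)) = - rotated"
proof (rule ext, clarify)
  fix v q
  show "(\<Sum>x\<in>C' \<rho>. (\<lambda>(v, q). if \<exists>r. q = r @ [Old (mate \<rho> x)] then - rotated (v, q) else 0)) (v, q) =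
      (- rotated) (v, q)"
  proof (cases "rotated (v, q) = 0")
    case True
    then show ?thesis by (auto simp: sum_fun_apply intro!: sum.neutral)
  next
    case False
    then obtain r c where q: "q = r @ [Old c]" "c \<in> Gamma' \<rho>" by (elim rotated_support)
    obtain x0 where x0: "x0 \<in> C' \<rho>" "mate \<rho> x0 = c"
      using mate_pair(1,2)[OF q(2)] by (cases "mate_pair \<rho> c") blast
    have "(\<exists>r. q = r @ [Old (mate \<rho> x)]) \<longleftrightarrow> x = x0" if "x \<in> C' \<rho>" for x
      using q(1) x0 that bij_betw_imp_inj_on[OF bij_betw_mate] by (auto dest: inj_onD)
    then have "(\<Sum>x\<in>C' \<rho>. if \<exists>r. q = r @ [Old (mate \<rho> x)] then - rotated (v, q) else 0) =
        (\<Sum>x\<in>C' \<rho>. if x = x0 then - rotated (v, q) else 0)"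
      by (intro sum.cong) auto
    then show ?thesis using x0(1) by (simp add: sum_fun_apply)
  qed
qed

lemma snd_premutation:
  "snd (premutation k (Q, W_rho Q \<rho> + S)) =
    (\<Sum>c\<in>C_all Q k. star_cycle Q c) + (\<Sum>c\<in>C' \<rho>. rho_cycle c) + bracket Q k S"
proof -
  have "(u, p) \<in> paths Q \<and> u \<noteq> k" if "(W_rho Q \<rho> + S) (u, p) \<noteq> 0" for u p
  proof (cases "S (u, p) = 0")
    case True
    then have "W_rho Q \<rho> (u, p) \<noteq> (0 :: 'k)" using that by simp
    then obtain a b where ab: "(a, b) \<in> C' \<rho>" "u = tail Q a" "p = [a, b, mate \<rho> (a, b)]"
      by (rule W_rho_support)
    then show ?thesis
      using matched_triangle(1)[OF ab(1)] C_allD(5)[of a b] C'_subset by (auto simp: paths_iff)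
  next
    case False
    then show ?thesis using S_support by (auto simp: paths_iff)
  qed
  \<comment> \<open>No term starts at \<open>k\<close>: the triangles of \<open>W_rho\<close> start
    at the tail of \<alpha>, and \<open>S\<close> is admissible.\<close>
  then have "rotate_off Q k (W_rho Q \<rho> + S) = W_rho Q \<rho> + S" by (rule rotate_off_id)
  then show ?thesis
    by (simp add: premutation_def bracket_def path_map_add bracket_W_rho[unfolded bracket_def] add.assoc)
qed

text \<open>The star cycles over \<open>C'\<close> cancel in the first substitution. What it leaves
  besides the terms \<open>rho_cycle\<close> contains no matched composite and survives the second
  unchanged; writing \<open>substituted\<close> as \<open>S_star\<close> plus \<open>residue\<close>
  leaves the error \<open>residue - rotated\<close>.\<close>

lemma subst_premutation:
  "subst_series P subst_comp (subst_series P subst_old (snd (premutation k (Q, W_rho Q \<rho> + S)))) =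
    (W_star Q k \<rho> S + (\<Sum>c\<in>C' \<rho>. rho_cycle c)) + (residue - rotated)"
proof -
  have "subst_series P subst_old (snd (premutation k (Q, W_rho Q \<rho> + S))) =
      (\<Sum>c\<in>C_all Q k. star_cycle Q c) + ((\<Sum>c\<in>C' \<rho>. rho_cycle c) - (\<Sum>c\<in>C' \<rho>. star_cycle Q c)) + substituted"
    by (simp add: snd_premutation P.subst_series_add P.subst_series_sum subst_old_star_cycle
        subst_old_rho_cycle sum_subtractf substituted_def)
  also have "\<dots> = (\<Sum>c\<in>C_all Q k - C' \<rho>. star_cycle Q c) + (\<Sum>c\<in>C' \<rho>. rho_cycle c) + substituted"
    unfolding sum.subset_diff[OF C'_subset finite_C_all, of "star_cycle Q"] by (simp add: fun_eq_iff)
  finally have 1: "subst_series P subst_old (snd (premutation k (Q, W_rho Q \<rho> + S))) =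
      (\<Sum>c\<in>C_all Q k - C' \<rho>. star_cycle Q c) + (\<Sum>c\<in>C' \<rho>. rho_cycle c) + substituted" .
  have 2: "subst_series P subst_comp (\<Sum>c\<in>C_all Q k - C' \<rho>. star_cycle Q c) = (\<Sum>c\<in>C_all Q k - C' \<rho>. star_cycle Q c)"
  proof (rule subst_comp_fixed)
    show "(\<Sum>c\<in>C_all Q k - C' \<rho>. star_cycle Q c) \<in> carrier (path_algebra P)"
      unfolding P.carrier_path_algebra
      by (auto simp: P.paths_iff intro: star_cycle_awalk elim!: star_cycle_sum_support)
  qed (auto elim!: star_cycle_sum_support)
  have 3: "subst_series P subst_comp substituted = substituted"
  proof (rule subst_comp_fixed)
    show "substituted \<in> carrier (path_algebra P)"
      unfolding substituted_def by (rule P.subst_series_carrier[OF is_subst_old])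
  qed (rule substituted_support(3))
  have 4: "subst_series P subst_comp (\<Sum>c\<in>C' \<rho>. rho_cycle c) = (\<Sum>c\<in>C' \<rho>. rho_cycle c) - rotated"
    by (simp add: P.subst_series_sum subst_comp_rho_cycle sum.distrib rotated_eq_sum)
  show ?thesis
    unfolding 1 P.subst_series_add 2 3 4 by (simp add: W_star_def residue_def fun_eq_iff)
qed

end

section \<open>Direct sums\<close>

text \<open>\<open>h\<close> is a section of \<open>M\<close> over the arrows of \<open>H\<close>,
  so for series on \<open>H\<close> pulling back along \<open>M\<close> is pushing forward along
  \<open>h\<close>. This reconciles \<open>relabel\<close> with the inclusions used by
  \<open>qp_sum\<close>.\<close>

lemma relabel_eq_path_map:
  fixes H Q :: "('v, 'e) pre_digraph" and Q' :: "('v, 'f) pre_digraph"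
  assumes M: "arrow_bij Q' Q M" and verts: "verts H = verts Q'" and "inj h"
    and h: "\<And>x. x \<in> arcs H \<Longrightarrow> h x \<in> arcs Q' \<and> tail Q' (h x) = tail H x \<and> head Q' (h x) = head H x"
    and Mh: "\<And>x. x \<in> arcs H \<Longrightarrow> M (h x) = x"
    and V: "\<And>u p. V (u, p) \<noteq> 0 \<Longrightarrow> (u, p) \<in> paths H"
  shows "relabel Q' M V = path_map H (map_prod id (map h)) V"
proof (rule ext, clarify)
  fix u and q :: "'f list"
  show "relabel Q' M V (u, q) = path_map H (map_prod id (map h)) V (u, q)"
  proof (cases "\<exists>p. (u, p) \<in> paths H \<and> q = map h p")
    case True
    then obtain p where p: "(u, p) \<in> paths H" "q = map h p" by blast
    have "map (M \<circ> h) p = p"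
      using p(1) Mh by (intro map_idI) (auto simp: paths_def pre_digraph.awalk_def)
    moreover have "(u, q) \<in> paths Q'"
      using p awalk_map[of H u p _ Q' h] verts h by (auto simp: paths_def)
    ultimately have "relabel Q' M V (u, q) = V (u, p)"
      using p(2) by (simp add: relabel_def)
    then show ?thesis
      using path_map_inj[OF inj_map_prod_map[OF \<open>inj h\<close>] p(1), of V] p(2) by simp
  next
    case False
    have "relabel Q' M V (u, q) = 0"
    proof (rule ccontr)
      assume "relabel Q' M V (u, q) \<noteq> 0"
      then have q: "(u, q) \<in> paths Q'" "(u, map M q) \<in> paths H"
        using V by (auto simp: relabel_def split: if_splits)
      have inj: "inj_on M (arcs Q')" using M by (simp add: arrow_bij_def bij_betw_def)
      have "h (M y) = y" if "y \<in> set q" for y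
      proof (rule inj_onD[OF inj])
        have "M y \<in> arcs H" using q(2) that by (auto simp: paths_def pre_digraph.awalk_def)
        then show "M (h (M y)) = M y" "h (M y) \<in> arcs Q'" using h Mh by auto
        show "y \<in> arcs Q'" using q(1) that by (auto simp: paths_def pre_digraph.awalk_def)
      qed
      then have "q = map h (map M q)" by (simp add: map_idI)
      then show False using False q(2) by blast
    qed
    moreover have "path_map H (map_prod id (map h)) V (u, q) = 0"
      using False by (intro ccontr[of "_ = 0"]) (auto elim!: path_map_nonzeroE)
    ultimately show ?thesis by simp
  qed
qed

lemma fin_digraph_quiver_sum:
  assumes "fin_digraph Q" "fin_digraph Q'" "verts Q = verts Q'"
  shows "fin_digraph (quiver_sum Q Q')"
  using assms unfolding fin_digraph_def fin_digraph_axioms_def wf_digraph_def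
  by (auto simp: quiver_sum_def)

lemma is_qp_sum:
  assumes "is_qp X" "is_qp Y" "verts (fst X) = verts (fst Y)"
  shows "is_qp (X \<oplus>\<^sub>q\<^sub>p Y)"
proof -
  let ?S = "quiver_sum (fst X) (fst Y)"
  have "pre_digraph.awalk ?S u p u \<and> 2 \<le> length p" if nz: "snd (X \<oplus>\<^sub>q\<^sub>p Y) (u, p) \<noteq> 0" for u p
  proof -
    consider q where "p = map Inl q" "snd X (u, q) \<noteq> 0" | q where "p = map Inr q" "snd Y (u, q) \<noteq> 0"
    proof -
      from nz consider "path_map (fst X) (map_prod id (map Inl)) (snd X) (u, p) \<noteq> 0"
        | "path_map (fst Y) (map_prod id (map Inr)) (snd Y) (u, p) \<noteq> 0"
        by (fastforce simp: qp_sum_def)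
      then show thesis
        by cases (auto elim!: path_map_nonzeroE intro: that)
    qed
    then show ?thesis
    proof cases
      case 1
      then show ?thesis
        using assms(1) awalk_map[of "fst X" u q u ?S Inl]
        by (auto simp: is_qp_def is_potential_def quiver_sum_def)
    next
      case 2
      then show ?thesis
        using assms(2,3) awalk_map[of "fst Y" u q u ?S Inr]
        by (auto simp: is_qp_def is_potential_def quiver_sum_def)
    qed
  qed
  then show ?thesis
    using assms by (simp add: is_qp_def is_potential_def fin_digraph_quiver_sum qp_sum_def)
qed

lemma cyclically_equivalent_refl: "cyclically_equivalent Q V V"
proof -
  have "(0 :: ('k::field, 'v, 'e) series) \<in> commutator_span Q" for Q :: "('v, 'e) pre_digraph"
    unfolding commutator_span_def by (rule Modules.module.span_zero[OF module_series])
  then show ?thesis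
    by (auto simp: cyclically_equivalent_def adic_closure_def path_algebra_def intro!: bexI[of _ 0])
qed

lemma path_algebra_iso_id: "path_algebra_iso Q Q id"
  by (auto simp: path_algebra_iso_def ring_iso_def ring_hom_def)

section \<open>Mutation\<close>

context matched_potential
begin

lemma is_qp_premutation: "is_qp (premutation k (Q, W_rho Q \<rho> + S))"
proof -
  have "P.awalk u p u \<and> 2 \<le> length p"
    if nz: "snd (premutation k (Q, W_rho Q \<rho> + S)) (u, p) \<noteq> 0" for u p
  proof -
    consider "(\<Sum>c\<in>C_all Q k. star_cycle Q c) (u, p) \<noteq> (0 :: 'k)"
      | "(\<Sum>c\<in>C' \<rho>. rho_cycle c) (u, p) \<noteq> (0 :: 'k)" | "bracket Q k S (u, p) \<noteq> 0"
      using nz by (fastforce simp: snd_premutation)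
    then show ?thesis
    proof cases
      case 1
      then show ?thesis by (rule star_cycle_sum_support) (simp add: star_cycle_awalk)
    next
      case 2
      then show ?thesis by (rule rho_cycle_sum_support) (simp add: matched_triangle)
    next
      case 3
      then show ?thesis using bracket_S_support by blast
    qed
  qed
  then show ?thesis
    using fin_digraph_P by (simp add: is_qp_def is_potential_def premutation_def)
qed

lemma W_star_support:
  assumes "W_star Q k \<rho> S (u, p) \<noteq> 0"
  shows "pre_digraph.awalk D u p u" "2 \<le> length p"
proof -
  consider "(\<Sum>c\<in>C_all Q k - C' \<rho>. star_cycle Q c) (u, p) \<noteq> (0 :: 'k)" | "S_star Q k \<rho> S (u, p) \<noteq> 0"
    using assms by (fastforce simp: W_star_def)
  then have "pre_digraph.awalk D u p u \<and> 2 \<le> length p"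
  proof cases
    case 1
    then obtain a b where ab: "(a, b) \<in> C_all Q k - C' \<rho>" "u = tail Q a" "p = [Comp a b, Star b, Star a]"
      by (rule star_cycle_sum_support)
    then show ?thesis using star_cycle_awalk[of a b] by (auto simp: awalk_D_iff)
  next
    case 2
    then show ?thesis using S_star_support by blast
  qed
  then show "pre_digraph.awalk D u p u" "2 \<le> length p" by auto
qed

lemma is_qp_dual: "is_qp (D, W_star Q k \<rho> S)"
  using fin_digraph_D W_star_support by (simp add: is_qp_def is_potential_def)

lemma bracket_W_rho_support:
  assumes "bracket Q k (W_rho Q \<rho>) (u, p) \<noteq> (0 :: 'k)"
  shows "pre_digraph.awalk R u p u" "length p = 2"
proof -
  obtain a b where "(a, b) \<in> C' \<rho>" "u = tail Q a" "p = [Comp a b, Old (mate \<rho> (a, b))]"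
    using assms unfolding bracket_W_rho by (rule rho_cycle_sum_support)
  then show "pre_digraph.awalk R u p u" "length p = 2"
    using matched_triangle(2)[of a b] mate(1)[of a b] by (auto simp: awalk_R_iff)
qed

lemma is_qp_R: "is_qp (R, bracket Q k (W_rho Q \<rho>) :: ('k, _, _) series)"
  using fin_digraph_R bracket_W_rho_support by (simp add: is_qp_def is_potential_def)

text \<open>The dual quiver and \<open>Q_rho\<close> divide the arrows of the pre-mutation into two
  disjoint sets, so forgetting the summand is a bijection.\<close>

lemma arrow_bij_sum: "arrow_bij (quiver_sum D R) P (case_sum id id)"
proof -
  have "fin_digraph (quiver_sum D R)"
    using fin_digraph_D fin_digraph_R by (intro fin_digraph_quiver_sum) auto
  then have "wf_digraph (quiver_sum D R)" by (simp add: fin_digraph_def)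
  moreover have "bij_betw (case_sum id id) (arcs (quiver_sum D R)) (arcs P)"
    by (rule bij_betw_byWitness[where f' = "\<lambda>x. if x \<in> arcs R then Inr x else Inl x"])
       (use matched_old_subset matched_comp_subset in \<open>auto simp: quiver_sum_def arcs_D\<close>)
  ultimately show ?thesis
    using P.wf_digraph by (auto simp: arrow_bij_def quiver_sum_def)
qed

theorem premutation_right_equivalent:
  "right_equivalent (premutation k (Q, W_rho Q \<rho> + S))
    ((D, W_star Q k \<rho> S) \<oplus>\<^sub>q\<^sub>p (R, bracket Q k (W_rho Q \<rho>)))"
proof -
  let ?S = "quiver_sum D R" and ?M = "case_sum id id :: _ \<Rightarrow> 'e mut_arrow"
  let ?W = "snd (premutation k (Q, W_rho Q \<rho> + S))"
  define \<phi> where "\<phi> = relabel ?S ?M \<circ> (subst_series P subst_comp \<circ> subst_series P (subst_old :: _ \<Rightarrow> ('k, _, _) series))"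
  have "path_algebra_iso P P (subst_series P subst_comp \<circ> subst_series P (subst_old :: _ \<Rightarrow> ('k, _, _) series))"
    by (rule path_algebra_iso_comp[OF refl P.wf_digraph path_algebra_iso_subst_old path_algebra_iso_subst_comp])
  then have iso: "path_algebra_iso P ?S \<phi>"
    unfolding \<phi>_def
    by (rule path_algebra_iso_comp[OF refl P.wf_digraph _ path_algebra_iso_relabel[OF arrow_bij_sum]])
  have "relabel ?S ?M (W_star Q k \<rho> S) = path_map D (map_prod id (map Inl)) (W_star Q k \<rho> S)"
    by (rule relabel_eq_path_map[OF arrow_bij_sum])
       (use W_star_support in \<open>auto simp: quiver_sum_def paths_def\<close>)
  moreover have "relabel ?S ?M (bracket Q k (W_rho Q \<rho>)) =
      path_map R (map_prod id (map Inr)) (bracket Q k (W_rho Q \<rho>) :: ('k, _, _) series)"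
    by (rule relabel_eq_path_map[OF arrow_bij_sum])
       (use bracket_W_rho_support in \<open>auto simp: quiver_sum_def paths_def\<close>)
  ultimately have sum: "relabel ?S ?M (W_star Q k \<rho> S + bracket Q k (W_rho Q \<rho>)) =
      snd ((D, W_star Q k \<rho> S) \<oplus>\<^sub>q\<^sub>p (R, bracket Q k (W_rho Q \<rho>)))"
    by (simp add: relabel_add qp_sum_def)
  have "(W_star Q k \<rho> S + bracket Q k (W_rho Q \<rho>) + (residue - rotated)) -
      (W_star Q k \<rho> S + bracket Q k (W_rho Q \<rho>)) = residue - rotated"
    by (simp add: fun_eq_iff)
  \<comment> \<open>Cyclic equivalence depends only on the difference, which here is
    \<open>residue - rotated\<close>.\<close>
  then have "cyclically_equivalent P
      (subst_series P subst_comp (subst_series P subst_old ?W)) (W_star Q k \<rho> S + bracket Q k (W_rho Q \<rho>))"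
    using cyclically_equivalent_residue
    unfolding subst_premutation cyclically_equivalent_def bracket_W_rho by simp
  then have "cyclically_equivalent ?S (\<phi> ?W) (snd ((D, W_star Q k \<rho> S) \<oplus>\<^sub>q\<^sub>p (R, bracket Q k (W_rho Q \<rho>))))"
    unfolding \<phi>_def comp_apply sum[symmetric] by (rule relabel_cyclically_equivalent[OF arrow_bij_sum])
  moreover have "is_qp ((D, W_star Q k \<rho> S) \<oplus>\<^sub>q\<^sub>p (R, bracket Q k (W_rho Q \<rho>)))"
    by (rule is_qp_sum[OF is_qp_dual is_qp_R]) simp
  moreover have "fst (premutation k (Q, W_rho Q \<rho> + S)) = P"
    "fst ((D, W_star Q k \<rho> S) \<oplus>\<^sub>q\<^sub>p (R, bracket Q k (W_rho Q \<rho>))) = ?S"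
    by (simp_all add: premutation_def qp_sum_def)
  moreover have "verts P = verts ?S" by (simp add: quiver_sum_def)
  ultimately show ?thesis
    using iso is_qp_premutation unfolding right_equivalent_def by metis
qed

end

section \<open>Maximal matchings and 2-cycles of the dual quiver\<close>

context matched_quiver
begin

text \<open>Starred arrows are exactly those at \<open>k\<close>, so a 2-cycle has two of them or
  none. Two starred or two old arrows come from a 2-cycle of \<open>Q\<close>, and for two
  composites [\<alpha>\<beta>] and [\<alpha>'\<beta>'] the path \<beta>\<alpha>' would be one.
  Maximality excludes the mixed case.\<close>

lemma dual_no_two_cycle:
  assumes Q: "\<nexists>a b. two_cycle Q a b" and max: "maximal_matching Q k \<rho>"
  shows "\<not> two_cycle D x y"
proof
  \<comment> \<open>Both arrows are unmatched in the same block, so neither side of the block is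
    exhausted, whereas maximality uses up the smaller side.\<close>
  have comp_old: False if D: "Comp a b \<in> arcs D" "Old c \<in> arcs D"
    and c: "head Q b = tail Q c" "head Q c = tail Q a" for a b c
  proof -
    have C: "(a, b) \<in> C_all Q k" "(a, b) \<notin> C' \<rho>" and c': "c \<in> arcs Q" "c \<notin> Gamma' \<rho>"
      using D by (auto simp: arcs_D arcs_P)
    note ab = C_allD[OF C(1)]
    let ?C = "C_ij Q k (tail Q a) (head Q b)" and ?G = "Gamma_ij Q (tail Q a) (head Q b)"
    have fin: "finite ?C" "finite ?G"
      by (auto simp: C_ij_def Gamma_ij_def intro: finite_subset[of _ "arcs Q \<times> arcs Q"])
    have "C' \<rho> \<inter> ?C \<subset> ?C" using C(2) ab by (auto simp: C_ij_def)
    then have 1: "card (C' \<rho> \<inter> ?C) < card ?C" by (rule psubset_card_mono[OF fin(1)])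
    have "Gamma' \<rho> \<inter> ?G \<subset> ?G" using c c' by (auto simp: Gamma_ij_def)
    then have 2: "card (Gamma' \<rho> \<inter> ?G) < card ?G" by (rule psubset_card_mono[OF fin(2)])
    have "card (C' \<rho> \<inter> ?C) = min (card ?C) (card ?G)" "card (Gamma' \<rho> \<inter> ?G) = min (card ?C) (card ?G)"
      using max ab by (auto simp: maximal_matching_def)
    then show False using 1 2 by linarith
  qed
  assume xy: "two_cycle D x y"
  then have arcs: "x \<in> arcs P" "y \<in> arcs P" and ends: "mut_head Q x = mut_tail Q y" "mut_head Q y = mut_tail Q x"
    by (auto simp: two_cycle_def arcs_D)
  have D: "x \<in> arcs D" "y \<in> arcs D" using xy by (auto simp: two_cycle_def)
  have star: "mut_tail Q z = k \<or> mut_head Q z = k \<longleftrightarrow> (\<exists>a. z = Star a)" if "z \<in> arcs P" for z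
    using that C_allD(5,6) by (cases z) (auto simp: arcs_P)
  have "\<not> two_cycle Q a b" for a b using Q by blast
  note no = this[unfolded two_cycle_def]
  have "(\<exists>a. x = Star a) \<longleftrightarrow> (\<exists>a. y = Star a)"
    using star[OF arcs(1)] star[OF arcs(2)] ends by metis
  then consider a b where "x = Star a" "y = Star b" | a b where "x = Old a" "y = Old b"
    | a b c where "x = Old c" "y = Comp a b" | a b c where "x = Comp a b" "y = Old c"
    | a b a' b' where "x = Comp a b" "y = Comp a' b'"
    by (cases x; cases y) auto
  then show False
  proof cases
    case 1
    then show ?thesis using no[of a b] arcs ends by (auto simp: arcs_P)
  next
    case 2
    then show ?thesis using no[of a b] arcs ends by (auto simp: arcs_P)
  next
    case 3
    then show ?thesis using comp_old[of a b c] D ends by simp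
  next
    case 4
    then show ?thesis using comp_old[of a b c] D ends by simp
  next
    case 5
    then show ?thesis using no[of b a'] arcs ends by (auto simp: arcs_P C_all_iff)
  qed
qed

text \<open>The removed 2-cycles pair each matched composite with its mate. A further 2-cycle
  disjoint from all of them would lie entirely in the dual quiver.\<close>

lemma dual_quiver_mutation:
  assumes "\<nexists>a b. two_cycle Q a b" "maximal_matching Q k \<rho>"
  shows "is_quiver_mutation Q k D"
proof -
  define T where "T = (\<lambda>x. {case_prod Comp x, Old (mate \<rho> x)}) ` C' \<rho>"
  have Union: "\<Union>T = matched_old \<union> matched_comp"
    using bij_betw_imp_surj_on[OF bij_betw_mate] by (auto simp: T_def)
  have "T \<subseteq> two_cycles P"
  proof
    fix z assume "z \<in> T"
    then obtain a b where ab: "(a, b) \<in> C' \<rho>" "z = {Comp a b, Old (mate \<rho> (a, b))}"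
      by (auto simp: T_def)
    then have "two_cycle P (Comp a b) (Old (mate \<rho> (a, b)))"
      using matched_triangle(2)[OF ab(1)] by (auto simp: two_cycle_def P.awalk_simps)
    then show "z \<in> two_cycles P" using ab(2) by (auto simp: two_cycles_def)
  qed
  moreover have "disjoint T"
    using bij_betw_imp_inj_on[OF bij_betw_mate] by (auto simp: T_def disjoint_def dest: inj_onD)
  moreover have "T' = T" if T': "T \<subseteq> T'" "T' \<subseteq> two_cycles P" "disjoint T'" for T'
  proof (rule ccontr)
    assume "T' \<noteq> T"
    then obtain z where z: "z \<in> T'" "z \<notin> T" using T'(1) by blast
    then obtain x y where xy: "z = {x, y}" "two_cycle P x y"
      using T'(2) by (auto simp: two_cycles_def)
    have "z \<inter> w = {}" if "w \<in> T" for w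
      using disjointD[OF T'(3) z(1)] T'(1) that z(2) by blast
    then have "z \<inter> (matched_old \<union> matched_comp) = {}" unfolding Union[symmetric] by blast
    then have "two_cycle D x y" using xy by (auto simp: two_cycle_def arcs_D)
    then show False using dual_no_two_cycle[OF assms] by blast
  qed
  moreover have "D = P\<lparr>arcs := arcs P - \<Union>T\<rparr>"
    by (rule pre_digraph.equality) (auto simp: Union arcs_D)
  ultimately show ?thesis unfolding is_quiver_mutation_def by blast
qed

end

section \<open>The reduced and the trivial summand\<close>

context matched_potential
begin

lemma is_reduced_dual:
  assumes "\<nexists>a b. two_cycle Q a b" "maximal_matching Q k \<rho>"
  shows "is_reduced (D, W_star Q k \<rho> S)"
proof -
  interpret D: fin_digraph D by (rule fin_digraph_D)
  have "3 \<le> length p" if "W_star Q k \<rho> S (u, p) \<noteq> 0" for u p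
  proof (rule ccontr)
    assume "\<not> 3 \<le> length p"
    then have "length p = Suc (Suc 0)" using W_star_support(2)[OF that] by simp
    then obtain x y where "p = [x, y]" by (auto simp: length_Suc_conv)
    then have "two_cycle D x y"
      using W_star_support(1)[OF that] by (auto simp: two_cycle_def D.awalk_simps)
    then show False using dual_no_two_cycle[OF assms] by blast
  qed
  then show ?thesis using is_qp_dual by (simp add: is_reduced_def)
qed

text \<open>The potential is already the sum of the 2-cycles [\<alpha>\<beta>]\<gamma>, so no change
  of arrows is required; listing \<open>C'\<close> supplies the indexed families.\<close>

lemma is_trivial_R: "is_trivial (R, bracket Q k (W_rho Q \<rho>) :: ('k, _, _) series)"
proof -
  obtain xs where xs: "set xs = C' \<rho>" "distinct xs"
    using finite_distinct_list[OF finite_C'] by blast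
  define as where "as = map (case_prod Comp) xs"
  define bs where "bs = map (\<lambda>x. Old (mate \<rho> x)) xs"
  have "inj_on (mate \<rho>) (set xs)"
    using bij_betw_imp_inj_on[OF bij_betw_mate] xs(1) by simp
  then have "distinct (as @ bs)"
    using xs(2) by (auto simp: as_def bs_def distinct_map inj_on_def)
  moreover have "set (as @ bs) = arcs R"
    using xs(1) bij_betw_imp_surj_on[OF bij_betw_mate] by (auto simp: as_def bs_def)
  moreover have "two_cycle R (as ! r) (bs ! r)" if "r < length as" for r
  proof -
    obtain a b where ab: "xs ! r = (a, b)" by fastforce
    then have "(a, b) \<in> C' \<rho>" using that xs(1) nth_mem[of r xs] by (auto simp: as_def)
    then show ?thesis
      using mate[of a b] that ab by (auto simp: two_cycle_def as_def bs_def)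
  qed
  moreover have "(\<Sum>r<length as. path_elem (tail R (as ! r), [as ! r, bs ! r])) =
      (bracket Q k (W_rho Q \<rho>) :: ('k, _, _) series)"
  proof -
    have "(\<Sum>r<length as. path_elem (tail R (as ! r), [as ! r, bs ! r])) =
        (\<Sum>r<length xs. rho_cycle (xs ! r) :: ('k, _, _) series)"
      by (auto simp: as_def bs_def rho_cycle_def case_prod_unfold intro!: sum.cong)
    also have "\<dots> = (\<Sum>x\<in>C' \<rho>. rho_cycle x)"
      using sum.reindex_bij_betw[OF bij_betw_nth[OF xs(2) refl xs(1)[symmetric]]] .
    finally show ?thesis by (simp add: bracket_W_rho)
  qed
  moreover have "loopfree_digraph R"
  proof -
    interpret R: fin_digraph R by (rule fin_digraph_R)
    show ?thesis
      using C'_subset C_allD(10) Gamma'D(1) no_loops by unfold_locales auto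
  qed
  ultimately show ?thesis
    unfolding is_trivial_def fst_conv snd_conv
    by (intro conjI exI[of _ as] exI[of _ bs] exI[of _ id])
       (auto simp: is_qp_R path_algebra_iso_id cyclically_equivalent_refl as_def bs_def)
qed

text \<open>Part (a) exhibits the splitting, and \<open>Q_rho\<close> has its arrows in the same
  type as the pre-mutation, as \<open>is_reduced_part\<close> demands of the trivial
  summand.\<close>

theorem dual_is_mutation:
  assumes "\<nexists>a b. two_cycle Q a b" "maximal_matching Q k \<rho>"
  shows "is_mutation k (Q, W_rho Q \<rho> + S) (D, W_star Q k \<rho> S)"
  unfolding is_mutation_def is_reduced_part_def
  using is_reduced_dual[OF assms] is_trivial_R premutation_right_equivalent by blast

end

theorem theorem2p40:
  fixes Q :: "('v, 'e) pre_digraph" and k :: 'v and \<rho> :: "'e matching"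
    and S :: "('k::field, 'v, 'e) series"
  assumes "fin_digraph Q" and "loopfree_digraph Q" and "k \<in> verts Q"
    and "\<And>a b. two_cycle Q a b \<Longrightarrow> tail Q a \<noteq> k \<and> tail Q b \<noteq> k"
    and "is_matching Q k \<rho>" and "is_admissible Q k \<rho> S"
  shows "right_equivalent (premutation k (Q, W_rho Q \<rho> + S))
           ((dual_quiver Q k \<rho>, W_star Q k \<rho> S) \<oplus>\<^sub>q\<^sub>p (Q_rho Q \<rho>, bracket Q k (W_rho Q \<rho>))) \<and>
         ((\<nexists>a b. two_cycle Q a b) \<and> maximal_matching Q k \<rho> \<longrightarrow>
           is_quiver_mutation Q k (dual_quiver Q k \<rho>) \<and>
           is_mutation k (Q, W_rho Q \<rho> + S) (dual_quiver Q k \<rho>, W_star Q k \<rho> S))"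
proof -
  interpret matched_potential Q k \<rho> S
    using assms unfolding matched_potential_def matched_potential_axioms_def matched_quiver_def
      matched_quiver_axioms_def by blast
  show ?thesis
    using premutation_right_equivalent dual_quiver_mutation dual_is_mutation by blast
qed

end
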